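(* Let $\mathcal{L}=(L_1,L_2,P,\&_1,\swarrow^1,\nwarrow_1,\dots,\&_n,\swarrow^n,\nwarrow_n)$ be a multi-adjoint frame and let $(X,Y,\phi)$ be a context of $\mathcal{L}$, i.e. sets $X$ (properties), $Y$ (objects), a map $\phi:X\times Y\to P$ and a map $|\cdot|:Y\to\{1,\dots,n\}$. Let $\phi_F:X\to\!\!\!\!\circ\; Y$ be the $\mathcal{Q}_F^{\mathcal{L}}$-relation with $|x|=-1$ for $x\in X$, the given types $|y|$ for $y\in Y$, and $\phi_F(x,y)=\phi(x,y)\in\mathcal{Q}_F^{\mathcal{L}}(-1,|y|)=P$. Then the multi-adjoint concept lattice of $(X,Y,\phi)$ is isomorphic, as a complete lattice, to the $0$-fibre $(\mathcal{M}\phi_F)_0$ of the complete $\mathcal{Q}_F^{\mathcal{L}}$-category $\mathcal{M}\phi_F$ of fixed points of the Isbell adjunction induced by $\phi_F$.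
   Context: Multi-adjoint frame: complete lattices $L_1,L_2,P$ and for $i=1,\dots,n$ maps $\&_i:L_1\times L_2\to P$, $\swarrow^i:P\times L_2\to L_1$, $\nwarrow_i:P\times L_1\to L_2$ with $x\,\&_i\,y\le z\iff x\le z\swarrow^i y\iff y\le z\nwarrow_i x$. Quantaloid $\mathcal{Q}_F^{\mathcal{L}}$: objects $-1,0,1,\dots,n$; $\mathcal{Q}_F^{\mathcal{L}}(-1,0)=L_1$, $\mathcal{Q}_F^{\mathcal{L}}(0,i)=L_2$, $\mathcal{Q}_F^{\mathcal{L}}(-1,i)=P$ ($1\le i\le n$); $\mathcal{Q}_F^{\mathcal{L}}(i,i)=\{\bot_{i,i}<\mathrm{id}_i\}$; all other hom-sets are one-element; composition $v\circ u=u\,\&_i\,v$ for $u\in L_1=\mathcal{Q}_F^{\mathcal{L}}(-1,0)$, $v\in L_2=\mathcal{Q}_F^{\mathcal{L}}(0,i)$, identities act as identities, other composites are bottom. Its left/right implications (defined by $v\circ u\le w\iff v\le w/u\iff u\le v\backslash w$) are $w/u=w\nwarrow_i u$ and $v\backslash w=w\swarrow^i v$ for $u\in L_1$, $v\in L_2$, $w\in P=\mathcal{Q}_F^{\mathcal{L}}(-1,i)$. For a quantaloid $\mathcal{Q}$ and sets $X,Y$ typed by maps into the objects of $\mathcal{Q}$, a $\mathcal{Q}$-relation $\phi:X\to\!\!\!\!\circ\; Y$ assigns $\phi(x,y)\in\mathcal{Q}(|x|,|y|)$. Regarding $X,Y$ as discrete $\mathcal{Q}$-categories, a presheaf of type $q$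 on $X$ is a map $\mu$ with $\mu(x)\in\mathcal{Q}(|x|,q)$, and a copresheaf of type $q$ on $Y$ is a map $\lambda$ with $\lambda(y)\in\mathcal{Q}(q,|y|)$. The presheaf $\mathcal{Q}$-category $\mathcal{P}X$ has hom $\bigwedge_x\mu'(x)/\mu(x)$; its underlying order on presheaves of a fixed type is the pointwise order. The Isbell adjunction sends a presheaf $\mu$ of type $q$ to the copresheaf $(\phi_\uparrow\mu)(y)=\bigwedge_{x\in X}\phi(x,y)/\mu(x)$ and a copresheaf $\lambda$ of type $q$ to the presheaf $(\phi^\downarrow\lambda)(x)=\bigwedge_{y\in Y}\lambda(y)\backslash\phi(x,y)$. $\mathcal{M}\phi=\{\mu\in\mathcal{P}X\mid\phi^\downarrow\phi_\uparrow\mu=\mu\}$ with the $\mathcal{Q}$-category structure inherited from $\mathcal{P}X$, and its $q$-fibre $(\mathcal{M}\phi)_q$ is the set of its elements of type $q$ with the underlying (pointwise) order. Concretely, $(\mathcal{M}\phi_F)_0=\{\mu\in L_1^X\mid\mu=\mu^{\uparrow\downarrow}\}$ ordered pointwise, where for $\mu\in L_1^X$, $\lambda\in L_2^Y$: $\mu^\uparrow(y)=\bigwedge_{x\in X}\phi(x,y)\nwarrow_{|y|}\mu(x)$ and $\lambda^\downarrow(x)=\bigwedge_{y\in Y}\phi(x,y)\swarrow^{|y|}\lambda(y)$. The multi-adjoint concept lattice of $(X,Y,\phi)$ is the complete lattice of fixed points of this Galois connection $\uparrow:L_1^X\rightleftarrows L_2^Y:\downarrow$, i.e. the set of pairs $(\lambda,\mu)\in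 L_2^Y\times L_1^X$ with $\mu^\uparrow=\lambda$ and $\lambda^\downarrow=\mu$, ordered by $(\lambda_1,\mu_1)\le(\lambda_2,\mu_2)$ iff $\mu_1\le\mu_2$ pointwise (equivalently $\lambda_2\le\lambda_1$ pointwise). *)

theory Defs
  imports "HOL-Algebra.Complete_Lattice" "HOL-Library.FuncSet"
begin

section \<open>Isomorphism of complete lattices\<close>

text \<open>\<^const>\<open>sup_pres\<close> and \<^const>\<open>inf_pres\<close> include the requirement that both
  orders are complete lattices.\<close>

definition complete_lattice_iso ::
    "('a, 'c) gorder_scheme \<Rightarrow> ('b, 'd) gorder_scheme \<Rightarrow> ('a \<Rightarrow> 'b) \<Rightarrow> bool" where
  "complete_lattice_iso L M f \<longleftrightarrow>
     bij_betw f (carrier L) (carrier M) \<and> sup_pres L M f \<and> inf_pres L M f"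

definition complete_lattice_isomorphic ::
    "('a, 'c) gorder_scheme \<Rightarrow> ('b, 'd) gorder_scheme \<Rightarrow> bool" where
  "complete_lattice_isomorphic L M \<longleftrightarrow> (\<exists>f. complete_lattice_iso L M f)"


section \<open>Multi-adjoint frames, contexts and concept lattices\<close>

text \<open>\<open>amp i x y\<close>, \<open>sw i z y\<close> and \<open>nw i z x\<close> stand for \<open>x &\<^sub>i y\<close>,
  \<open>z \<swarrow>\<^sup>i y\<close> and \<open>z \<nwarrow>\<^sub>i x\<close>; only indices \<open>i \<in> {1..n}\<close> are relevant.\<close>

locale multi_adjoint_frame =
  fixes n :: nat
    and amp :: "nat \<Rightarrow> 'l1::complete_lattice \<Rightarrow> 'l2::complete_lattice \<Rightarrow> 'p::complete_lattice"
    and sw :: "nat \<Rightarrow> 'p \<Rightarrow> 'l2 \<Rightarrow> 'l1"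
    and nw :: "nat \<Rightarrow> 'p \<Rightarrow> 'l1 \<Rightarrow> 'l2"
  assumes adj_sw: "i \<in> {1..n} \<Longrightarrow> amp i x y \<le> z \<longleftrightarrow> x \<le> sw i z y"
    and adj_nw: "i \<in> {1..n} \<Longrightarrow> amp i x y \<le> z \<longleftrightarrow> y \<le> nw i z x"

text \<open>Maps out of the sets \<open>X\<close> and \<open>Y\<close> are represented by extensional functions.\<close>

definition concept_up ::
    "(nat \<Rightarrow> 'p \<Rightarrow> 'l1 \<Rightarrow> 'l2::complete_lattice) \<Rightarrow> 'x set \<Rightarrow> 'y set \<Rightarrow> ('x \<Rightarrow> 'y \<Rightarrow> 'p)
      \<Rightarrow> ('y \<Rightarrow> nat) \<Rightarrow> ('x \<Rightarrow> 'l1) \<Rightarrow> 'y \<Rightarrow> 'l2" where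
  "concept_up nw X Y phi ty mu = (\<lambda>y\<in>Y. INF x\<in>X. nw (ty y) (phi x y) (mu x))"

definition concept_down ::
    "(nat \<Rightarrow> 'p \<Rightarrow> 'l2 \<Rightarrow> 'l1::complete_lattice) \<Rightarrow> 'x set \<Rightarrow> 'y set \<Rightarrow> ('x \<Rightarrow> 'y \<Rightarrow> 'p)
      \<Rightarrow> ('y \<Rightarrow> nat) \<Rightarrow> ('y \<Rightarrow> 'l2) \<Rightarrow> 'x \<Rightarrow> 'l1" where
  "concept_down sw X Y phi ty lam = (\<lambda>x\<in>X. INF y\<in>Y. sw (ty y) (phi x y) (lam y))"

definition concept_lattice ::
    "(nat \<Rightarrow> 'p \<Rightarrow> 'l2 \<Rightarrow> 'l1::complete_lattice) \<Rightarrow> (nat \<Rightarrow> 'p \<Rightarrow> 'l1 \<Rightarrow> 'l2::complete_lattice)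
      \<Rightarrow> 'x set \<Rightarrow> 'y set \<Rightarrow> ('x \<Rightarrow> 'y \<Rightarrow> 'p) \<Rightarrow> ('y \<Rightarrow> nat)
      \<Rightarrow> (('y \<Rightarrow> 'l2) \<times> ('x \<Rightarrow> 'l1)) gorder" where
  "concept_lattice sw nw X Y phi ty =
     \<lparr>carrier = {(lam, mu). lam \<in> Y \<rightarrow>\<^sub>E UNIV \<and> mu \<in> X \<rightarrow>\<^sub>E UNIV \<and>
                   concept_up nw X Y phi ty mu = lam \<and> concept_down sw X Y phi ty lam = mu},
      eq = (=),
      le = (\<lambda>(lam, mu) (lam', mu'). \<forall>x\<in>X. mu x \<le> mu' x)\<rparr>"


section \<open>Quantaloids\<close>

text \<open>\<open>Cmp Q p q r v u\<close> is the composite \<open>v \<circ> u\<close> of \<open>u : p \<rightarrow> q\<close> and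
  \<open>v : q \<rightarrow> r\<close>. Arrows of different hom-sets need not be distinct.\<close>

record ('o, 'a) quantaloid_data =
  Ob :: "'o set"
  Hom :: "'o \<Rightarrow> 'o \<Rightarrow> 'a gorder"
  Idt :: "'o \<Rightarrow> 'a"
  Cmp :: "'o \<Rightarrow> 'o \<Rightarrow> 'o \<Rightarrow> 'a \<Rightarrow> 'a \<Rightarrow> 'a"

locale quantaloid =
  fixes Q :: "('o, 'a) quantaloid_data"
  assumes hom_complete: "\<lbrakk>p \<in> Ob Q; q \<in> Ob Q\<rbrakk> \<Longrightarrow> complete_lattice (Hom Q p q)"
    and idt_closed: "p \<in> Ob Q \<Longrightarrow> Idt Q p \<in> carrier (Hom Q p p)"
    and cmp_closed: "\<lbrakk>p \<in> Ob Q; q \<in> Ob Q; r \<in> Ob Q;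
          u \<in> carrier (Hom Q p q); v \<in> carrier (Hom Q q r)\<rbrakk>
        \<Longrightarrow> Cmp Q p q r v u \<in> carrier (Hom Q p r)"
    and cmp_assoc: "\<lbrakk>p \<in> Ob Q; q \<in> Ob Q; r \<in> Ob Q; s \<in> Ob Q;
          u \<in> carrier (Hom Q p q); v \<in> carrier (Hom Q q r); w \<in> carrier (Hom Q r s)\<rbrakk>
        \<Longrightarrow> Cmp Q p r s w (Cmp Q p q r v u) = Cmp Q p q s (Cmp Q q r s w v) u"
    and idt_left: "\<lbrakk>p \<in> Ob Q; q \<in> Ob Q; u \<in> carrier (Hom Q p q)\<rbrakk>
        \<Longrightarrow> Cmp Q p q q (Idt Q q) u = u"
    and idt_right: "\<lbrakk>p \<in> Ob Q; q \<in> Ob Q; u \<in> carrier (Hom Q p q)\<rbrakk>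
        \<Longrightarrow> Cmp Q p p q u (Idt Q p) = u"
    and cmp_sup_right: "\<lbrakk>p \<in> Ob Q; q \<in> Ob Q; r \<in> Ob Q; v \<in> carrier (Hom Q q r)\<rbrakk>
        \<Longrightarrow> sup_pres (Hom Q p q) (Hom Q p r) (\<lambda>u. Cmp Q p q r v u)"
    and cmp_sup_left: "\<lbrakk>p \<in> Ob Q; q \<in> Ob Q; r \<in> Ob Q; u \<in> carrier (Hom Q p q)\<rbrakk>
        \<Longrightarrow> sup_pres (Hom Q q r) (Hom Q p r) (\<lambda>v. Cmp Q p q r v u)"

text \<open>For \<open>u : p \<rightarrow> q\<close>, \<open>v : q \<rightarrow> r\<close> and \<open>w : p \<rightarrow> r\<close>: \<open>left_impl Q p q r w u\<close>
  is \<open>w / u : q \<rightarrow> r\<close>, and \<open>right_impl Q p q r v w\<close> is \<open>v \<setminus> w : p \<rightarrow> q\<close>.\<close>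

definition left_impl ::
    "('o, 'a) quantaloid_data \<Rightarrow> 'o \<Rightarrow> 'o \<Rightarrow> 'o \<Rightarrow> 'a \<Rightarrow> 'a \<Rightarrow> 'a" where
  "left_impl Q p q r w u =
     (THE z. z \<in> carrier (Hom Q q r) \<and>
        (\<forall>v\<in>carrier (Hom Q q r).
           Cmp Q p q r v u \<sqsubseteq>\<^bsub>Hom Q p r\<^esub> w \<longleftrightarrow> v \<sqsubseteq>\<^bsub>Hom Q q r\<^esub> z))"

definition right_impl ::
    "('o, 'a) quantaloid_data \<Rightarrow> 'o \<Rightarrow> 'o \<Rightarrow> 'o \<Rightarrow> 'a \<Rightarrow> 'a \<Rightarrow> 'a" where
  "right_impl Q p q r v w =
     (THE z. z \<in> carrier (Hom Q p q) \<and>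
        (\<forall>u\<in>carrier (Hom Q p q).
           Cmp Q p q r v u \<sqsubseteq>\<^bsub>Hom Q p r\<^esub> w \<longleftrightarrow> u \<sqsubseteq>\<^bsub>Hom Q p q\<^esub> z))"


section \<open>Categories and relations over a quantaloid\<close>

record ('o, 'a, 'c) qcat_data =
  Elt :: "'c set"
  Typ :: "'c \<Rightarrow> 'o"
  QHom :: "'c \<Rightarrow> 'c \<Rightarrow> 'a"

locale qcat = quantaloid Q
  for Q :: "('o, 'a) quantaloid_data" +
  fixes A :: "('o, 'a, 'c) qcat_data"
  assumes typ_closed: "a \<in> Elt A \<Longrightarrow> Typ A a \<in> Ob Q"
    and qhom_closed: "\<lbrakk>a \<in> Elt A; b \<in> Elt A\<rbrakk>
        \<Longrightarrow> QHom A a b \<in> carrier (Hom Q (Typ A a) (Typ A b))"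
    and qhom_refl: "a \<in> Elt A
        \<Longrightarrow> Idt Q (Typ A a) \<sqsubseteq>\<^bsub>Hom Q (Typ A a) (Typ A a)\<^esub> QHom A a a"
    and qhom_trans: "\<lbrakk>a \<in> Elt A; b \<in> Elt A; c \<in> Elt A\<rbrakk>
        \<Longrightarrow> Cmp Q (Typ A a) (Typ A b) (Typ A c) (QHom A b c) (QHom A a b)
              \<sqsubseteq>\<^bsub>Hom Q (Typ A a) (Typ A c)\<^esub> QHom A a c"

text \<open>The \<open>q\<close>-fibre carries the underlying order: \<open>a \<le> b\<close> iff
  \<open>id\<^sub>q \<le> A(a, b)\<close>.\<close>

definition fibre ::
    "('o, 'a) quantaloid_data \<Rightarrow> ('o, 'a, 'c) qcat_data \<Rightarrow> 'o \<Rightarrow> 'c gorder" where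
  "fibre Q A q =
     \<lparr>carrier = {a \<in> Elt A. Typ A a = q},
      eq = (=),
      le = (\<lambda>a b. Idt Q q \<sqsubseteq>\<^bsub>Hom Q q q\<^esub> QHom A a b)\<rparr>"

text \<open>A relation is given by its two typed sets and its matrix of arrows.\<close>

record ('o, 'a, 'x, 'y) qrel_data =
  Src :: "'x set"
  STyp :: "'x \<Rightarrow> 'o"
  Tgt :: "'y set"
  TTyp :: "'y \<Rightarrow> 'o"
  Val :: "'x \<Rightarrow> 'y \<Rightarrow> 'a"

locale qrel = quantaloid Q
  for Q :: "('o, 'a) quantaloid_data" +
  fixes R :: "('o, 'a, 'x, 'y) qrel_data"
  assumes styp_closed: "x \<in> Src R \<Longrightarrow> STyp R x \<in> Ob Q"
    and ttyp_closed: "y \<in> Tgt R \<Longrightarrow> TTyp R y \<in> Ob Q"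
    and val_closed: "\<lbrakk>x \<in> Src R; y \<in> Tgt R\<rbrakk>
        \<Longrightarrow> Val R x y \<in> carrier (Hom Q (STyp R x) (TTyp R y))"

text \<open>Presheaves on a discrete category on a typed set. The type \<open>q\<close> is part of the
  presheaf: it is not determined by the underlying function in general.\<close>

definition presheaves ::
    "('o, 'a) quantaloid_data \<Rightarrow> 'x set \<Rightarrow> ('x \<Rightarrow> 'o) \<Rightarrow> ('o \<times> ('x \<Rightarrow> 'a)) set" where
  "presheaves Q X t =
     {(q, mu). q \<in> Ob Q \<and> mu \<in> (\<Pi>\<^sub>E x\<in>X. carrier (Hom Q (t x) q))}"

definition presheaf_qcat ::
    "('o, 'a) quantaloid_data \<Rightarrow> 'x set \<Rightarrow> ('x \<Rightarrow> 'o)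
      \<Rightarrow> ('o, 'a, 'o \<times> ('x \<Rightarrow> 'a)) qcat_data" where
  "presheaf_qcat Q X t =
     \<lparr>Elt = presheaves Q X t,
      Typ = fst,
      QHom = (\<lambda>(q, mu) (q', mu').
        \<Sqinter>\<^bsub>Hom Q q q'\<^esub> ((\<lambda>x. left_impl Q (t x) q q' (mu' x) (mu x)) ` X))\<rparr>"

definition isbell_up ::
    "('o, 'a) quantaloid_data \<Rightarrow> ('o, 'a, 'x, 'y) qrel_data
      \<Rightarrow> 'o \<times> ('x \<Rightarrow> 'a) \<Rightarrow> 'o \<times> ('y \<Rightarrow> 'a)" where
  "isbell_up Q R = (\<lambda>(q, mu). (q, \<lambda>y\<in>Tgt R.
     \<Sqinter>\<^bsub>Hom Q q (TTyp R y)\<^esub>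
       ((\<lambda>x. left_impl Q (STyp R x) q (TTyp R y) (Val R x y) (mu x)) ` Src R)))"

definition isbell_down ::
    "('o, 'a) quantaloid_data \<Rightarrow> ('o, 'a, 'x, 'y) qrel_data
      \<Rightarrow> 'o \<times> ('y \<Rightarrow> 'a) \<Rightarrow> 'o \<times> ('x \<Rightarrow> 'a)" where
  "isbell_down Q R = (\<lambda>(q, lam). (q, \<lambda>x\<in>Src R.
     \<Sqinter>\<^bsub>Hom Q (STyp R x) q\<^esub>
       ((\<lambda>y. right_impl Q (STyp R x) q (TTyp R y) (lam y) (Val R x y)) ` Tgt R)))"

definition isbell_fixed ::
    "('o, 'a) quantaloid_data \<Rightarrow> ('o, 'a, 'x, 'y) qrel_data
      \<Rightarrow> ('o, 'a, 'o \<times> ('x \<Rightarrow> 'a)) qcat_data" where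
  "isbell_fixed Q R =
     (presheaf_qcat Q (Src R) (STyp R))
       \<lparr>Elt := {m \<in> presheaves Q (Src R) (STyp R). isbell_down Q R (isbell_up Q R m) = m}\<rparr>"


section \<open>The quantaloid of a multi-adjoint frame\<close>

text \<open>One type for the arrows of all hom-sets: \<open>Bot\<close> is the element of the one-element
  hom-sets and the bottom of the two-element hom-sets \<open>{\<bottom>\<^sub>i\<^sub>,\<^sub>i < id\<^sub>i}\<close>.\<close>

datatype ('l1, 'l2, 'p) arrow = InL1 'l1 | InL2 'l2 | InP 'p | Bot | Unit

fun arrow_le ::
    "('l1::ord, 'l2::ord, 'p::ord) arrow \<Rightarrow> ('l1, 'l2, 'p) arrow \<Rightarrow> bool" where
  "arrow_le (InL1 a) (InL1 b) = (a \<le> b)"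
| "arrow_le (InL2 a) (InL2 b) = (a \<le> b)"
| "arrow_le (InP a) (InP b) = (a \<le> b)"
| "arrow_le Bot Bot = True"
| "arrow_le Bot Unit = True"
| "arrow_le Unit Unit = True"
| "arrow_le _ _ = False"

definition QF_hom :: "int \<Rightarrow> int \<Rightarrow> ('l1::ord, 'l2::ord, 'p::ord) arrow gorder" where
  "QF_hom p q =
     \<lparr>carrier =
        (if p = -1 \<and> q = 0 then range InL1
         else if p = 0 \<and> 1 \<le> q then range InL2
         else if p = -1 \<and> 1 \<le> q then range InP
         else if p = q then {Bot, Unit}
         else {Bot}),
      eq = (=),
      le = arrow_le\<rparr>"

definition QF_cmp ::
    "(nat \<Rightarrow> 'l1::ord \<Rightarrow> 'l2::ord \<Rightarrow> 'p::ord) \<Rightarrow> int \<Rightarrow> int \<Rightarrow> int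
      \<Rightarrow> ('l1, 'l2, 'p) arrow \<Rightarrow> ('l1, 'l2, 'p) arrow \<Rightarrow> ('l1, 'l2, 'p) arrow" where
  "QF_cmp amp p q r v u =
     (if p = q \<and> u = Unit then v
      else if q = r \<and> v = Unit then u
      else case (u, v) of
        (InL1 a, InL2 b) \<Rightarrow> InP (amp (nat r) a b)
      | _ \<Rightarrow> \<bottom>\<^bsub>QF_hom p r\<^esub>)"

definition QF ::
    "nat \<Rightarrow> (nat \<Rightarrow> 'l1::ord \<Rightarrow> 'l2::ord \<Rightarrow> 'p::ord)
      \<Rightarrow> (int, ('l1, 'l2, 'p) arrow) quantaloid_data" where
  "QF n amp =
     \<lparr>Ob = {-1..int n}, Hom = QF_hom, Idt = (\<lambda>_. Unit), Cmp = QF_cmp amp\<rparr>"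

definition QF_rel ::
    "'x set \<Rightarrow> 'y set \<Rightarrow> ('x \<Rightarrow> 'y \<Rightarrow> 'p) \<Rightarrow> ('y \<Rightarrow> nat)
      \<Rightarrow> (int, ('l1, 'l2, 'p) arrow, 'x, 'y) qrel_data" where
  "QF_rel X Y phi ty =
     \<lparr>Src = X, STyp = (\<lambda>_. -1), Tgt = Y, TTyp = (\<lambda>y. int (ty y)),
      Val = (\<lambda>x y. InP (phi x y))\<rparr>"



section \<open>Well-definedness\<close>

lemma sup_presI:
  assumes L: "complete_lattice L" and M: "complete_lattice M"
    and f: "\<And>x. x \<in> carrier L \<Longrightarrow> f x \<in> carrier M"
    and g: "\<And>y. y \<in> carrier M \<Longrightarrow> g y \<in> carrier L"
    and adj: "\<And>x y. \<lbrakk>x \<in> carrier L; y \<in> carrier M\<rbrakk>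
      \<Longrightarrow> f x \<sqsubseteq>\<^bsub>M\<^esub> y \<longleftrightarrow> x \<sqsubseteq>\<^bsub>L\<^esub> g y"
  shows "sup_pres L M f"
proof -
  interpret L: complete_lattice L by fact
  interpret M: complete_lattice M by fact
  have "f (\<Squnion>\<^bsub>L\<^esub>A) = \<Squnion>\<^bsub>M\<^esub>(f ` A)" if A: "A \<subseteq> carrier L" for A
  proof -
    have fA: "f ` A \<subseteq> carrier M" using A f by auto
    have sA: "\<Squnion>\<^bsub>L\<^esub>A \<in> carrier L" and sfA: "\<Squnion>\<^bsub>M\<^esub>(f ` A) \<in> carrier M"
      using A fA by auto
    have mem: "a \<in> carrier L" "f a \<in> carrier M" if "a \<in> A" for a
      using A f that by auto
    have "\<Squnion>\<^bsub>L\<^esub>A \<sqsubseteq>\<^bsub>L\<^esub> g (\<Squnion>\<^bsub>M\<^esub>(f ` A))"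
    proof (rule L.sup_least[OF A g[OF sfA]])
      fix a assume a: "a \<in> A"
      then have "f a \<sqsubseteq>\<^bsub>M\<^esub> \<Squnion>\<^bsub>M\<^esub>(f ` A)" by (intro M.sup_upper imageI fA)
      then show "a \<sqsubseteq>\<^bsub>L\<^esub> g (\<Squnion>\<^bsub>M\<^esub>(f ` A))" using adj[OF mem(1)[OF a] sfA] by simp
    qed
    then have 1: "f (\<Squnion>\<^bsub>L\<^esub>A) \<sqsubseteq>\<^bsub>M\<^esub> \<Squnion>\<^bsub>M\<^esub>(f ` A)"
      using adj[OF sA sfA] by simp
    have "f a \<sqsubseteq>\<^bsub>M\<^esub> f (\<Squnion>\<^bsub>L\<^esub>A)" if a: "a \<in> A" for a
    proof -
      have "a \<sqsubseteq>\<^bsub>L\<^esub> \<Squnion>\<^bsub>L\<^esub>A" by (rule L.sup_upper[OF A a])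
      moreover have "\<Squnion>\<^bsub>L\<^esub>A \<sqsubseteq>\<^bsub>L\<^esub> g (f (\<Squnion>\<^bsub>L\<^esub>A))"
        using adj[OF sA f[OF sA]] M.le_refl[OF f[OF sA]] by simp
      ultimately have "a \<sqsubseteq>\<^bsub>L\<^esub> g (f (\<Squnion>\<^bsub>L\<^esub>A))"
        by (rule L.le_trans) (intro mem(1)[OF a] sA g f)+
      then show ?thesis using adj[OF mem(1)[OF a] f[OF sA]] by simp
    qed
    then have 2: "\<Squnion>\<^bsub>M\<^esub>(f ` A) \<sqsubseteq>\<^bsub>M\<^esub> f (\<Squnion>\<^bsub>L\<^esub>A)"
      by (intro M.sup_least fA f sA) auto
    show ?thesis by (rule M.le_antisym[OF 1 2 f[OF sA] sfA])
  qed
  with L M show ?thesis by (auto simp: sup_pres_def)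
qed

lemma sup_pres_adjoint:
  assumes pres: "sup_pres L M f"
    and f: "\<And>x. x \<in> carrier L \<Longrightarrow> f x \<in> carrier M"
    and y: "y \<in> carrier M"
  shows "\<exists>!z. z \<in> carrier L \<and>
    (\<forall>x\<in>carrier L. f x \<sqsubseteq>\<^bsub>M\<^esub> y \<longleftrightarrow> x \<sqsubseteq>\<^bsub>L\<^esub> z)"
proof -
  interpret L: complete_lattice L using pres by (simp add: sup_pres_def)
  interpret M: complete_lattice M using pres by (simp add: sup_pres_def)
  define A where "A = {x \<in> carrier L. f x \<sqsubseteq>\<^bsub>M\<^esub> y}"
  have A: "A \<subseteq> carrier L" by (auto simp: A_def)
  have s: "\<Squnion>\<^bsub>L\<^esub>A \<in> carrier L" using A by auto
  have pres': "f (\<Squnion>\<^bsub>L\<^esub>B) = \<Squnion>\<^bsub>M\<^esub>(f ` B)" if "B \<subseteq> carrier L" for B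
    using pres that by (auto simp: sup_pres_def)
  have fs: "f (\<Squnion>\<^bsub>L\<^esub>A) \<sqsubseteq>\<^bsub>M\<^esub> y"
    unfolding pres'[OF A] using A f y by (intro M.sup_least) (auto simp: A_def)
  have mono: "f a \<sqsubseteq>\<^bsub>M\<^esub> f b"
    if "a \<in> carrier L" "b \<in> carrier L" "a \<sqsubseteq>\<^bsub>L\<^esub> b" for a b
  proof -
    have "\<Squnion>\<^bsub>L\<^esub>{a, b} = b"
      using that by (intro L.le_antisym L.sup_least L.sup_upper) auto
    then have "f b = \<Squnion>\<^bsub>M\<^esub>(f ` {a, b})" using pres'[of "{a, b}"] that by auto
    moreover have "f a \<sqsubseteq>\<^bsub>M\<^esub> \<Squnion>\<^bsub>M\<^esub>(f ` {a, b})"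
      using that f by (intro M.sup_upper) auto
    ultimately show ?thesis by simp
  qed
  have ex: "\<forall>x\<in>carrier L. f x \<sqsubseteq>\<^bsub>M\<^esub> y \<longleftrightarrow> x \<sqsubseteq>\<^bsub>L\<^esub> \<Squnion>\<^bsub>L\<^esub>A"
  proof (intro ballI iffI)
    fix x assume "x \<in> carrier L" "f x \<sqsubseteq>\<^bsub>M\<^esub> y"
    then show "x \<sqsubseteq>\<^bsub>L\<^esub> \<Squnion>\<^bsub>L\<^esub>A" using A by (intro L.sup_upper) (auto simp: A_def)
  next
    fix x assume x: "x \<in> carrier L" "x \<sqsubseteq>\<^bsub>L\<^esub> \<Squnion>\<^bsub>L\<^esub>A"
    show "f x \<sqsubseteq>\<^bsub>M\<^esub> y"
      by (rule M.le_trans[OF mono[OF x(1) s x(2)] fs f[OF x(1)] f[OF s] y])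
  qed
  show ?thesis
  proof (intro ex1I conjI)
    fix z assume z: "z \<in> carrier L \<and> (\<forall>x\<in>carrier L. f x \<sqsubseteq>\<^bsub>M\<^esub> y \<longleftrightarrow> x \<sqsubseteq>\<^bsub>L\<^esub> z)"
    then have "z \<sqsubseteq>\<^bsub>L\<^esub> \<Squnion>\<^bsub>L\<^esub>A" "\<Squnion>\<^bsub>L\<^esub>A \<sqsubseteq>\<^bsub>L\<^esub> z"
      using ex s L.le_refl by metis+
    then show "z = \<Squnion>\<^bsub>L\<^esub>A" using L.le_antisym s z by metis
  qed (use s ex in auto)
qed

context quantaloid
begin

lemma left_impl:
  assumes "p \<in> Ob Q" "q \<in> Ob Q" "r \<in> Ob Q"
    and "u \<in> carrier (Hom Q p q)" "w \<in> carrier (Hom Q p r)"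
  shows "left_impl Q p q r w u \<in> carrier (Hom Q q r)"
    and "v \<in> carrier (Hom Q q r) \<Longrightarrow>
      Cmp Q p q r v u \<sqsubseteq>\<^bsub>Hom Q p r\<^esub> w \<longleftrightarrow> v \<sqsubseteq>\<^bsub>Hom Q q r\<^esub> left_impl Q p q r w u"
  using theI'[OF sup_pres_adjoint[OF cmp_sup_left, OF assms(1-4) cmp_closed, OF assms(1-4) _ assms(5)]]
  unfolding left_impl_def by blast+

lemma right_impl:
  assumes "p \<in> Ob Q" "q \<in> Ob Q" "r \<in> Ob Q"
    and "v \<in> carrier (Hom Q q r)" "w \<in> carrier (Hom Q p r)"
  shows "right_impl Q p q r v w \<in> carrier (Hom Q p q)"
    and "u \<in> carrier (Hom Q p q) \<Longrightarrow>
      Cmp Q p q r v u \<sqsubseteq>\<^bsub>Hom Q p r\<^esub> w \<longleftrightarrow> u \<sqsubseteq>\<^bsub>Hom Q p q\<^esub> right_impl Q p q r v w"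
  using theI'[OF sup_pres_adjoint[OF cmp_sup_right, OF assms(1-4) cmp_closed, OF assms(1-3) _ assms(4,5)]]
  unfolding right_impl_def by blast+

lemma cmp_mono:
  assumes pqr: "p \<in> Ob Q" "q \<in> Ob Q" "r \<in> Ob Q"
    and u: "u \<in> carrier (Hom Q p q)" "u' \<in> carrier (Hom Q p q)" "u \<sqsubseteq>\<^bsub>Hom Q p q\<^esub> u'"
    and v: "v \<in> carrier (Hom Q q r)" "v' \<in> carrier (Hom Q q r)" "v \<sqsubseteq>\<^bsub>Hom Q q r\<^esub> v'"
  shows "Cmp Q p q r v u \<sqsubseteq>\<^bsub>Hom Q p r\<^esub> Cmp Q p q r v' u'"
proof -
  interpret pq: complete_lattice "Hom Q p q" by (rule hom_complete) fact+
  interpret qr: complete_lattice "Hom Q q r" by (rule hom_complete) fact+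
  interpret pr: complete_lattice "Hom Q p r" by (rule hom_complete) fact+
  let ?w = "Cmp Q p q r v' u'"
  have w: "?w \<in> carrier (Hom Q p r)" using assms by (intro cmp_closed)
  have "u' \<sqsubseteq>\<^bsub>Hom Q p q\<^esub> right_impl Q p q r v' ?w"
    using right_impl(2)[OF pqr v(2) w u(2)] w by simp
  then have "u \<sqsubseteq>\<^bsub>Hom Q p q\<^esub> right_impl Q p q r v' ?w"
    using pq.le_trans[OF u(3)] u(1,2) right_impl(1)[OF pqr v(2) w] by blast
  then have "Cmp Q p q r v' u \<sqsubseteq>\<^bsub>Hom Q p r\<^esub> ?w"
    using right_impl(2)[OF pqr v(2) w u(1)] by simp
  then have "v' \<sqsubseteq>\<^bsub>Hom Q q r\<^esub> left_impl Q p q r ?w u"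
    using left_impl(2)[OF pqr u(1) w v(2)] by simp
  then have "v \<sqsubseteq>\<^bsub>Hom Q q r\<^esub> left_impl Q p q r ?w u"
    using qr.le_trans[OF v(3)] v(1,2) left_impl(1)[OF pqr u(1) w] by blast
  then show ?thesis using left_impl(2)[OF pqr u(1) w v(1)] by simp
qed

lemma qcat_presheaf:
  assumes t: "\<And>x. x \<in> X \<Longrightarrow> t x \<in> Ob Q"
  shows "qcat Q (presheaf_qcat Q X t)"
proof -
  let ?A = "presheaf_qcat Q X t"
  have hom: "QHom ?A a b = \<Sqinter>\<^bsub>Hom Q (fst a) (fst b)\<^esub>
      ((\<lambda>x. left_impl Q (t x) (fst a) (fst b) (snd b x) (snd a x)) ` X)" for a b
    by (simp add: presheaf_qcat_def case_prod_beta)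
  have tp: "fst a \<in> Ob Q" if "a \<in> Elt ?A" for a
    using that by (auto simp: presheaf_qcat_def presheaves_def)
  have val: "snd a x \<in> carrier (Hom Q (t x) (fst a))" if "a \<in> Elt ?A" "x \<in> X" for a x
    using that by (auto simp: presheaf_qcat_def presheaves_def)
  have sub: "(\<lambda>x. left_impl Q (t x) (fst a) (fst b) (snd b x) (snd a x)) ` X
      \<subseteq> carrier (Hom Q (fst a) (fst b))" if "a \<in> Elt ?A" "b \<in> Elt ?A" for a b
    using that t by (intro image_subsetI left_impl(1) tp val)
  have cl: "QHom ?A a b \<in> carrier (Hom Q (fst a) (fst b))" if "a \<in> Elt ?A" "b \<in> Elt ?A" for a b
  proof -
    interpret complete_lattice "Hom Q (fst a) (fst b)"
      using that tp by (intro hom_complete)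
    show ?thesis unfolding hom by (intro inf_closed sub that)
  qed
  have le: "h \<sqsubseteq>\<^bsub>Hom Q (fst a) (fst b)\<^esub> QHom ?A a b \<longleftrightarrow>
      (\<forall>x\<in>X. Cmp Q (t x) (fst a) (fst b) h (snd a x) \<sqsubseteq>\<^bsub>Hom Q (t x) (fst b)\<^esub> snd b x)"
    if a: "a \<in> Elt ?A" and b: "b \<in> Elt ?A" and h: "h \<in> carrier (Hom Q (fst a) (fst b))" for a b h
  proof -
    interpret ab: complete_lattice "Hom Q (fst a) (fst b)"
      using a b tp by (intro hom_complete)
    have "h \<sqsubseteq>\<^bsub>Hom Q (fst a) (fst b)\<^esub> QHom ?A a b \<longleftrightarrow>
      (\<forall>x\<in>X. h \<sqsubseteq>\<^bsub>Hom Q (fst a) (fst b)\<^esub>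
         left_impl Q (t x) (fst a) (fst b) (snd b x) (snd a x))"
    proof (intro iffI ballI)
      fix x assume x: "x \<in> X" and l: "h \<sqsubseteq>\<^bsub>Hom Q (fst a) (fst b)\<^esub> QHom ?A a b"
      have "QHom ?A a b \<sqsubseteq>\<^bsub>Hom Q (fst a) (fst b)\<^esub>
         left_impl Q (t x) (fst a) (fst b) (snd b x) (snd a x)"
        unfolding hom using x sub[OF a b] by (intro ab.inf_lower) auto
      then show "h \<sqsubseteq>\<^bsub>Hom Q (fst a) (fst b)\<^esub>
         left_impl Q (t x) (fst a) (fst b) (snd b x) (snd a x)"
        using ab.le_trans[OF l] h cl[OF a b] sub[OF a b] x by blast
    next
      assume "\<forall>x\<in>X. h \<sqsubseteq>\<^bsub>Hom Q (fst a) (fst b)\<^esub>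
         left_impl Q (t x) (fst a) (fst b) (snd b x) (snd a x)"
      then show "h \<sqsubseteq>\<^bsub>Hom Q (fst a) (fst b)\<^esub> QHom ?A a b"
        unfolding hom using h sub[OF a b] by (intro ab.inf_greatest) auto
    qed
    then show ?thesis using left_impl(2)[OF t tp[OF a] tp[OF b] val[OF a] val[OF b] h] by simp
  qed
  have T: "Typ ?A = fst" by (simp add: presheaf_qcat_def)
  show ?thesis
  proof (unfold_locales, unfold T)
    fix a assume a: "a \<in> Elt ?A"
    have "snd a x \<sqsubseteq>\<^bsub>Hom Q (t x) (fst a)\<^esub> snd a x" if "x \<in> X" for x
    proof -
      interpret complete_lattice "Hom Q (t x) (fst a)"
        using a that tp t by (intro hom_complete)
      show ?thesis using val[OF a that] by simp
    qed
    then show "Idt Q (fst a) \<sqsubseteq>\<^bsub>Hom Q (fst a) (fst a)\<^esub> QHom ?A a a"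
      unfolding le[OF a a idt_closed[OF tp[OF a]]] using idt_left t tp val a by simp
  next
    fix a b c assume abc: "a \<in> Elt ?A" "b \<in> Elt ?A" "c \<in> Elt ?A"
    let ?p = "fst a" let ?q = "fst b" let ?r = "fst c"
    let ?h = "QHom ?A a b" let ?k = "QHom ?A b c"
    interpret ab: complete_lattice "Hom Q ?p ?q" using abc tp by (intro hom_complete)
    interpret bc: complete_lattice "Hom Q ?q ?r" using abc tp by (intro hom_complete)
    have kh: "Cmp Q ?p ?q ?r ?k ?h \<in> carrier (Hom Q ?p ?r)"
      using abc tp cl by (intro cmp_closed)
    show "Cmp Q ?p ?q ?r ?k ?h \<sqsubseteq>\<^bsub>Hom Q ?p ?r\<^esub> QHom ?A a c"
      unfolding le[OF abc(1,3) kh]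
    proof
      fix x assume x: "x \<in> X"
      interpret xb: complete_lattice "Hom Q (t x) ?q" using x abc t tp by (intro hom_complete)
      interpret xc: complete_lattice "Hom Q (t x) ?r" using x abc t tp by (intro hom_complete)
      have ha: "Cmp Q (t x) ?p ?q ?h (snd a x) \<in> carrier (Hom Q (t x) ?q)"
        using x abc t tp val cl by (intro cmp_closed)
      have 1: "Cmp Q (t x) ?p ?q ?h (snd a x) \<sqsubseteq>\<^bsub>Hom Q (t x) ?q\<^esub> snd b x"
        using le[OF abc(1,2) cl[OF abc(1,2)]] cl[OF abc(1,2)] x by simp
      have 2: "Cmp Q (t x) ?q ?r ?k (snd b x) \<sqsubseteq>\<^bsub>Hom Q (t x) ?r\<^esub> snd c x"
        using le[OF abc(2,3) cl[OF abc(2,3)]] cl[OF abc(2,3)] x by simp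
      have 3: "Cmp Q (t x) ?q ?r ?k (Cmp Q (t x) ?p ?q ?h (snd a x))
          \<sqsubseteq>\<^bsub>Hom Q (t x) ?r\<^esub> Cmp Q (t x) ?q ?r ?k (snd b x)"
        by (intro cmp_mono bc.le_refl 1 t tp val cl ha x abc)
      have "Cmp Q (t x) ?q ?r ?k (Cmp Q (t x) ?p ?q ?h (snd a x))
          \<sqsubseteq>\<^bsub>Hom Q (t x) ?r\<^esub> snd c x"
        by (rule xc.le_trans[OF 3 2]) (intro cmp_closed t tp val cl ha x abc)+
      moreover have "Cmp Q (t x) ?q ?r ?k (Cmp Q (t x) ?p ?q ?h (snd a x)) =
          Cmp Q (t x) ?p ?r (Cmp Q ?p ?q ?r ?k ?h) (snd a x)"
        by (intro cmp_assoc t tp val cl x abc)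
      ultimately show "Cmp Q (t x) ?p ?r (Cmp Q ?p ?q ?r ?k ?h) (snd a x)
          \<sqsubseteq>\<^bsub>Hom Q (t x) ?r\<^esub> snd c x" by simp
    qed
  qed (use tp cl in auto)
qed

end

lemma (in qrel) qcat_isbell_fixed: "qcat Q (isbell_fixed Q R)"
proof -
  interpret P: qcat Q "presheaf_qcat Q (Src R) (STyp R)"
    by (rule qcat_presheaf) (rule styp_closed)
  have elt: "a \<in> Elt (presheaf_qcat Q (Src R) (STyp R))" if "a \<in> Elt (isbell_fixed Q R)" for a
    using that by (simp add: isbell_fixed_def presheaf_qcat_def)
  have eqs: "Typ (isbell_fixed Q R) = Typ (presheaf_qcat Q (Src R) (STyp R))"
    "QHom (isbell_fixed Q R) = QHom (presheaf_qcat Q (Src R) (STyp R))"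
    by (simp_all add: isbell_fixed_def)
  show ?thesis
    by (unfold_locales, unfold eqs)
      ((rule P.typ_closed P.qhom_closed P.qhom_refl P.qhom_trans; rule elt; assumption)+)
qed


lemma complete_lattice_embedding:
  fixes c :: "'l::complete_lattice \<Rightarrow> 'a"
  assumes le: "\<And>a b. r (c a) (c b) \<longleftrightarrow> a \<le> b" and c: "inj c"
  shows "complete_lattice \<lparr>carrier = range c, eq = (=), le = r\<rparr>"
proof -
  let ?L = "\<lparr>carrier = range c, eq = (=), le = r\<rparr>"
  interpret partial_order ?L
    by unfold_locales (auto simp: le)
  show ?thesis
  proof
    fix A assume "A \<subseteq> carrier ?L"
    then obtain B where A: "A = c ` B" by (auto simp: subset_image_iff)
    have "least ?L (c (Sup B)) (Upper ?L A)"
    proof (unfold least_def Upper_def, intro conjI ballI)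
      fix x assume "x \<in> {u. \<forall>x. x \<in> A \<inter> carrier ?L \<longrightarrow> x \<sqsubseteq>\<^bsub>?L\<^esub> u} \<inter> carrier ?L"
      then obtain d where "x = c d" "\<And>b. b \<in> B \<Longrightarrow> b \<le> d"
        by (auto simp: A le[symmetric])
      then show "c (Sup B) \<sqsubseteq>\<^bsub>?L\<^esub> x" by (simp add: le Sup_le_iff)
    next
      show "c (Sup B) \<in> {u. \<forall>x. x \<in> A \<inter> carrier ?L \<longrightarrow> x \<sqsubseteq>\<^bsub>?L\<^esub> u} \<inter> carrier ?L"
        unfolding A using le by (simp, blast intro: Sup_upper)
    qed simp
    then show "\<exists>s. least ?L s (Upper ?L A)" ..
    have "greatest ?L (c (Inf B)) (Lower ?L A)"
    proof (unfold greatest_def Lower_def, intro conjI ballI)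
      fix x assume "x \<in> {l. \<forall>x. x \<in> A \<inter> carrier ?L \<longrightarrow> l \<sqsubseteq>\<^bsub>?L\<^esub> x} \<inter> carrier ?L"
      then obtain d where "x = c d" "\<And>b. b \<in> B \<Longrightarrow> d \<le> b"
        by (auto simp: A le[symmetric])
      then show "x \<sqsubseteq>\<^bsub>?L\<^esub> c (Inf B)" by (simp add: le le_Inf_iff)
    next
      show "c (Inf B) \<in> {l. \<forall>x. x \<in> A \<inter> carrier ?L \<longrightarrow> l \<sqsubseteq>\<^bsub>?L\<^esub> x} \<inter> carrier ?L"
        unfolding A using le by (simp, blast intro: Inf_lower)
    qed simp
    then show "\<exists>i. greatest ?L i (Lower ?L A)" ..
  qed
qed

lemma QF_hom_simps [simp]: "le (QF_hom p q) = arrow_le" "eq (QF_hom p q) = (=)"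
  by (simp_all add: QF_hom_def)

lemma complete_lattice_QF_hom:
  "complete_lattice (QF_hom p q ::
     ('l1::complete_lattice, 'l2::complete_lattice, 'p::complete_lattice) arrow gorder)"
proof -
  have bool: "range (\<lambda>b. if b then Unit else Bot) = {Bot, Unit}"
    by (auto simp: image_iff)
  have le: "arrow_le (if a then Unit else Bot) (if b then Unit else Bot :: ('l1, 'l2, 'p) arrow)
      \<longleftrightarrow> a \<le> b" for a b
    by simp
  have "inj (\<lambda>b. if b then Unit else Bot :: ('l1, 'l2, 'p) arrow)"
    by (rule injI) (simp split: if_splits)
  from complete_lattice_embedding[where r = arrow_le, OF le this]
  have two: "complete_lattice \<lparr>carrier = {Bot, Unit}, eq = (=),
      le = arrow_le :: ('l1, 'l2, 'p) arrow \<Rightarrow> _\<rparr>"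
    unfolding bool .
  have one: "complete_lattice \<lparr>carrier = {Bot}, eq = (=),
      le = arrow_le :: ('l1, 'l2, 'p) arrow \<Rightarrow> _\<rparr>"
  proof -
    interpret partial_order "\<lparr>carrier = {Bot}, eq = (=),
      le = arrow_le :: ('l1, 'l2, 'p) arrow \<Rightarrow> _\<rparr>" by unfold_locales auto
    show ?thesis
      by unfold_locales (auto simp: least_def greatest_def Upper_def Lower_def)
  qed
  have L1: "complete_lattice \<lparr>carrier = range InL1, eq = (=),
      le = arrow_le :: ('l1, 'l2, 'p) arrow \<Rightarrow> _\<rparr>"
    by (rule complete_lattice_embedding) (simp_all add: inj_def)
  have L2: "complete_lattice \<lparr>carrier = range InL2, eq = (=),
      le = arrow_le :: ('l1, 'l2, 'p) arrow \<Rightarrow> _\<rparr>"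
    by (rule complete_lattice_embedding) (simp_all add: inj_def)
  have P: "complete_lattice \<lparr>carrier = range InP, eq = (=),
      le = arrow_le :: ('l1, 'l2, 'p) arrow \<Rightarrow> _\<rparr>"
    by (rule complete_lattice_embedding) (simp_all add: inj_def)
  show ?thesis
    unfolding QF_hom_def using one two L1 L2 P by (simp split del: if_split split: if_split)
qed

lemma QF_hom_carrier:
  "u \<in> carrier (QF_hom p q) \<longleftrightarrow>
    (case u of
       InL1 _ \<Rightarrow> p = -1 \<and> q = 0
     | InL2 _ \<Rightarrow> p = 0 \<and> 1 \<le> q
     | InP _ \<Rightarrow> p = -1 \<and> 1 \<le> q
     | Bot \<Rightarrow> \<not> (p = -1 \<and> q = 0) \<and> \<not> (p = 0 \<and> 1 \<le> q) \<and> \<not> (p = -1 \<and> 1 \<le> q)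
     | Unit \<Rightarrow> p = q)"
  by (cases u) (auto simp: QF_hom_def)

lemma QF_hom_bottom:
  "\<bottom>\<^bsub>QF_hom p q\<^esub> =
    (if p = -1 \<and> q = 0 then InL1 bot
     else if p = 0 \<and> 1 \<le> q then InL2 bot
     else if p = -1 \<and> 1 \<le> q then InP bot
     else (Bot :: ('l1::complete_lattice, 'l2::complete_lattice, 'p::complete_lattice) arrow))"
  (is "_ = ?b")
proof -
  interpret complete_lattice "QF_hom p q :: ('l1, 'l2, 'p) arrow gorder"
    by (rule complete_lattice_QF_hom)
  have b: "?b \<in> carrier (QF_hom p q)" by (simp add: QF_hom_carrier)
  moreover have "?b \<sqsubseteq>\<^bsub>QF_hom p q\<^esub> u" if "u \<in> carrier (QF_hom p q)" for u
    using that by (cases u) (auto simp: QF_hom_carrier)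
  ultimately show ?thesis using bottom_lower[OF b] le_antisym bottom_closed by blast
qed

lemma QF_hom_bottom_le:
  fixes w :: "('l1::complete_lattice, 'l2::complete_lattice, 'p::complete_lattice) arrow"
  assumes "w \<in> carrier (QF_hom p q)"
  shows "arrow_le \<bottom>\<^bsub>QF_hom p q\<^esub> w"
  using assms by (cases w) (auto simp: QF_hom_carrier QF_hom_bottom)

lemma QF_cmp_Unit: "QF_cmp amp p p q u Unit = u" "QF_cmp amp p q q Unit u = u"
  by (simp_all add: QF_cmp_def)

lemma QF_cmp_bottom:
  assumes "u \<in> carrier (QF_hom p q)" "v \<in> carrier (QF_hom q r)" "u \<noteq> Unit" "v \<noteq> Unit"
    and "\<not> (p = -1 \<and> q = 0 \<and> 1 \<le> r)"
  shows "QF_cmp amp p q r v u = \<bottom>\<^bsub>QF_hom p r\<^esub>"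
  using assms by (cases u; cases v) (simp_all add: QF_cmp_def QF_hom_carrier)

context multi_adjoint_frame
begin

lemma adj_int:
  assumes "1 \<le> i" "i \<le> int n"
  shows "amp (nat i) x y \<le> z \<longleftrightarrow> x \<le> sw (nat i) z y"
    "y \<le> nw (nat i) z x \<longleftrightarrow> x \<le> sw (nat i) z y"
proof -
  have i: "nat i \<in> {1..n}" using assms by auto
  show "amp (nat i) x y \<le> z \<longleftrightarrow> x \<le> sw (nat i) z y"
    "y \<le> nw (nat i) z x \<longleftrightarrow> x \<le> sw (nat i) z y"
    using adj_sw[OF i] adj_nw[OF i] by auto
qed

lemma amp_bot:
  assumes "1 \<le> i" "i \<le> int n"
  shows "amp (nat i) bot y = bot" "amp (nat i) x bot = bot"
proof -
  have i: "nat i \<in> {1..n}" using assms by auto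
  show "amp (nat i) bot y = bot" "amp (nat i) x bot = bot"
    using adj_sw[OF i, of bot y bot] adj_nw[OF i, of x bot bot] by (auto simp: le_bot)
qed

lemma QF_cmp_bottom_right:
  assumes "v \<in> carrier (QF_hom q r)" "r \<le> int n"
  shows "QF_cmp amp p q r v \<bottom>\<^bsub>QF_hom p q\<^esub> = \<bottom>\<^bsub>QF_hom p r\<^esub>"
  using assms by (cases v) (auto simp: QF_cmp_def QF_hom_carrier QF_hom_bottom amp_bot)

lemma QF_cmp_bottom_left:
  assumes "u \<in> carrier (QF_hom p q)" "r \<le> int n"
  shows "QF_cmp amp p q r \<bottom>\<^bsub>QF_hom q r\<^esub> u = \<bottom>\<^bsub>QF_hom p r\<^esub>"
  using assms by (cases u) (auto simp: QF_cmp_def QF_hom_carrier QF_hom_bottom amp_bot)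

lemma QF_cmp_closed:
  assumes "u \<in> carrier (QF_hom p q)" "v \<in> carrier (QF_hom q r)"
  shows "QF_cmp amp p q r v u \<in> carrier (QF_hom p r)"
  using assms by (cases u; cases v) (auto simp: QF_cmp_def QF_hom_carrier QF_hom_bottom)

lemma QF_cmp_assoc:
  assumes le: "r \<le> int n" "s \<le> int n"
    and u: "u \<in> carrier (QF_hom p q)" and v: "v \<in> carrier (QF_hom q r)"
    and w: "w \<in> carrier (QF_hom r s)"
  shows "QF_cmp amp p r s w (QF_cmp amp p q r v u) = QF_cmp amp p q s (QF_cmp amp q r s w v) u"
proof (cases "u = Unit \<or> v = Unit \<or> w = Unit")
  case True
  then show ?thesis
  proof (elim disjE)
    assume "u = Unit"
    then have "u = Unit" "q = p" using u by (simp_all add: QF_hom_carrier)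
    then show ?thesis by (simp add: QF_cmp_Unit)
  next
    assume "v = Unit"
    then have "v = Unit" "r = q" using v by (simp_all add: QF_hom_carrier)
    then show ?thesis by (simp add: QF_cmp_Unit)
  next
    assume "w = Unit"
    then have "w = Unit" "s = r" using w by (simp_all add: QF_hom_carrier)
    then show ?thesis by (simp add: QF_cmp_Unit)
  qed
next
  case False
  then have nu: "u \<noteq> Unit" "v \<noteq> Unit" "w \<noteq> Unit" by auto
  have "QF_cmp amp p r s w (QF_cmp amp p q r v u) = \<bottom>\<^bsub>QF_hom p s\<^esub>"
  proof (cases "p = -1 \<and> q = 0 \<and> 1 \<le> r")
    case True
    with u v nu have "QF_cmp amp p q r v u \<noteq> Unit"
      by (cases u; cases v) (simp_all add: QF_cmp_def QF_hom_carrier)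
    then show ?thesis by (rule QF_cmp_bottom[OF QF_cmp_closed[OF u v] w _ nu(3)]) (use True in simp)
  next
    case False
    then show ?thesis using QF_cmp_bottom[OF u v nu(1,2)] QF_cmp_bottom_right[OF w le(2)] by simp
  qed
  moreover have "QF_cmp amp p q s (QF_cmp amp q r s w v) u = \<bottom>\<^bsub>QF_hom p s\<^esub>"
  proof (cases "q = -1 \<and> r = 0 \<and> 1 \<le> s")
    case True
    with v w nu have "QF_cmp amp q r s w v \<noteq> Unit"
      by (cases v; cases w) (simp_all add: QF_cmp_def QF_hom_carrier)
    then show ?thesis by (rule QF_cmp_bottom[OF u QF_cmp_closed[OF v w] nu(1)]) (use True in simp)
  next
    case False
    then show ?thesis using QF_cmp_bottom[OF v w nu(2,3)] QF_cmp_bottom_left[OF u le(2)] by simp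
  qed
  ultimately show ?thesis by simp
qed

lemma quantaloid_QF: "quantaloid (QF n amp)"
proof (rule quantaloid.intro)
  fix p q assume "p \<in> Ob (QF n amp)" "q \<in> Ob (QF n amp)"
  show "complete_lattice (Hom (QF n amp) p q)"
    by (simp add: QF_def complete_lattice_QF_hom)
next
  fix p assume "p \<in> Ob (QF n amp)"
  show "Idt (QF n amp) p \<in> carrier (Hom (QF n amp) p p)"
    by (simp add: QF_def QF_hom_carrier)
next
  fix p q r u v
  assume "u \<in> carrier (Hom (QF n amp) p q)" "v \<in> carrier (Hom (QF n amp) q r)"
  then show "Cmp (QF n amp) p q r v u \<in> carrier (Hom (QF n amp) p r)"
    by (simp add: QF_def QF_cmp_closed)
next
  fix p q r s u v w
  assume "p \<in> Ob (QF n amp)" "q \<in> Ob (QF n amp)" "r \<in> Ob (QF n amp)" "s \<in> Ob (QF n amp)"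
    "u \<in> carrier (Hom (QF n amp) p q)" "v \<in> carrier (Hom (QF n amp) q r)"
    "w \<in> carrier (Hom (QF n amp) r s)"
  then show "Cmp (QF n amp) p r s w (Cmp (QF n amp) p q r v u) =
      Cmp (QF n amp) p q s (Cmp (QF n amp) q r s w v) u"
    by (simp add: QF_def QF_cmp_assoc)
next
  fix p q u assume "u \<in> carrier (Hom (QF n amp) p q)"
  then show "Cmp (QF n amp) p q q (Idt (QF n amp) q) u = u"
    by (simp add: QF_def QF_cmp_def)
next
  fix p q u assume "u \<in> carrier (Hom (QF n amp) p q)"
  then show "Cmp (QF n amp) p p q u (Idt (QF n amp) p) = u"
    by (simp add: QF_def QF_cmp_def)
next
  fix p q r v
  assume ob: "p \<in> Ob (QF n amp)" "q \<in> Ob (QF n amp)" "r \<in> Ob (QF n amp)"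
    and v: "v \<in> carrier (Hom (QF n amp) q r)"
  define top_pq :: "('l1, 'l2, 'p) arrow" where "top_pq =
    (if p = -1 \<and> q = 0 then InL1 Orderings.top else if p = 0 \<and> 1 \<le> q then InL2 Orderings.top
     else if p = -1 \<and> 1 \<le> q then InP Orderings.top else if p = q then Unit else Bot)"
  define g where "g w =
    (if v = Unit then w
     else if p = q then (if arrow_le v w then Unit else Bot)
     else case (v, w) of (InL2 b, InP z) \<Rightarrow> InL1 (sw (nat r) z b) | _ \<Rightarrow> top_pq)" for w
  show "sup_pres (Hom (QF n amp) p q) (Hom (QF n amp) p r) (\<lambda>u. Cmp (QF n amp) p q r v u)"
  proof (rule sup_presI[where g = g])
    show "complete_lattice (Hom (QF n amp) p q)" "complete_lattice (Hom (QF n amp) p r)"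
      by (simp_all add: QF_def complete_lattice_QF_hom)
  next
    fix u assume "u \<in> carrier (Hom (QF n amp) p q)"
    with v show "Cmp (QF n amp) p q r v u \<in> carrier (Hom (QF n amp) p r)"
      by (simp add: QF_def QF_cmp_closed)
  next
    fix w assume "w \<in> carrier (Hom (QF n amp) p r)"
    with ob v show "g w \<in> carrier (Hom (QF n amp) p q)"
      by (cases v; cases w) (auto simp: g_def top_pq_def QF_def QF_hom_carrier)
  next
    fix u w assume "u \<in> carrier (Hom (QF n amp) p q)" "w \<in> carrier (Hom (QF n amp) p r)"
    then have u: "u \<in> carrier (QF_hom p q)" and w: "w \<in> carrier (QF_hom p r)"
      by (simp_all add: QF_def)
    have v': "v \<in> carrier (QF_hom q r)" and r: "r \<le> int n" using v ob by (simp_all add: QF_def)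
    have "arrow_le (QF_cmp amp p q r v u) w \<longleftrightarrow> arrow_le u (g w)"
    proof -
      consider "v = Unit" | "v \<noteq> Unit" "p = q" | "v \<noteq> Unit" "p = -1" "q = 0" "1 \<le> r"
        | "v \<noteq> Unit" "p \<noteq> q" "\<not> (p = -1 \<and> q = 0 \<and> 1 \<le> r)" by blast
      then show ?thesis
      proof cases
        case 1
        then show ?thesis using v' by (simp add: g_def QF_cmp_def QF_hom_carrier)
      next
        case 2
        with u have "u = Bot \<or> u = Unit" by (cases u) (auto simp: QF_hom_carrier)
        then show ?thesis
          using 2 QF_hom_bottom_le[OF w] by (auto simp: g_def QF_cmp_def)
      next
        case 3
        then show ?thesis using u v' w r
          by (cases u; cases v; cases w)
            (simp_all add: g_def QF_cmp_def QF_hom_carrier adj_int)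
      next
        case 4
        then have "u \<noteq> Unit" using u by (auto simp: QF_hom_carrier)
        with 4 have "QF_cmp amp p q r v u = \<bottom>\<^bsub>QF_hom p r\<^esub>"
          by (intro QF_cmp_bottom u v')
        moreover have "g w = top_pq" using 4 v' w
          by (cases v; cases w) (simp_all add: g_def QF_hom_carrier)
        moreover have "arrow_le u top_pq" using u 4
          by (cases u) (auto simp: top_pq_def QF_hom_carrier)
        ultimately show ?thesis using QF_hom_bottom_le[OF w] by simp
      qed
    qed
    then show "Cmp (QF n amp) p q r v u \<sqsubseteq>\<^bsub>Hom (QF n amp) p r\<^esub> w \<longleftrightarrow>
        u \<sqsubseteq>\<^bsub>Hom (QF n amp) p q\<^esub> g w"
      by (simp add: QF_def)
  qed
next
  fix p q r u
  assume ob: "p \<in> Ob (QF n amp)" "q \<in> Ob (QF n amp)" "r \<in> Ob (QF n amp)"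
    and u: "u \<in> carrier (Hom (QF n amp) p q)"
  define top_qr :: "('l1, 'l2, 'p) arrow" where "top_qr =
    (if q = -1 \<and> r = 0 then InL1 Orderings.top else if q = 0 \<and> 1 \<le> r then InL2 Orderings.top
     else if q = -1 \<and> 1 \<le> r then InP Orderings.top else if q = r then Unit else Bot)"
  define g where "g w =
    (if u = Unit then w
     else if q = r then (if arrow_le u w then Unit else Bot)
     else case (u, w) of (InL1 a, InP z) \<Rightarrow> InL2 (nw (nat r) z a) | _ \<Rightarrow> top_qr)" for w
  show "sup_pres (Hom (QF n amp) q r) (Hom (QF n amp) p r) (\<lambda>v. Cmp (QF n amp) p q r v u)"
  proof (rule sup_presI[where g = g])
    show "complete_lattice (Hom (QF n amp) q r)" "complete_lattice (Hom (QF n amp) p r)"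
      by (simp_all add: QF_def complete_lattice_QF_hom)
  next
    fix v assume "v \<in> carrier (Hom (QF n amp) q r)"
    with u show "Cmp (QF n amp) p q r v u \<in> carrier (Hom (QF n amp) p r)"
      by (simp add: QF_def QF_cmp_closed)
  next
    fix w assume "w \<in> carrier (Hom (QF n amp) p r)"
    with ob u show "g w \<in> carrier (Hom (QF n amp) q r)"
      by (cases u; cases w) (auto simp: g_def top_qr_def QF_def QF_hom_carrier)
  next
    fix v w assume "v \<in> carrier (Hom (QF n amp) q r)" "w \<in> carrier (Hom (QF n amp) p r)"
    then have v: "v \<in> carrier (QF_hom q r)" and w: "w \<in> carrier (QF_hom p r)"
      by (simp_all add: QF_def)
    have u': "u \<in> carrier (QF_hom p q)" and r: "r \<le> int n" using u ob by (simp_all add: QF_def)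
    have "arrow_le (QF_cmp amp p q r v u) w \<longleftrightarrow> arrow_le v (g w)"
    proof -
      consider "u = Unit" | "u \<noteq> Unit" "q = r" | "u \<noteq> Unit" "p = -1" "q = 0" "1 \<le> r"
        | "u \<noteq> Unit" "q \<noteq> r" "\<not> (p = -1 \<and> q = 0 \<and> 1 \<le> r)" by blast
      then show ?thesis
      proof cases
        case 1
        then show ?thesis using u' by (simp add: g_def QF_cmp_def QF_hom_carrier)
      next
        case 2
        with v have "v = Bot \<or> v = Unit" by (cases v) (auto simp: QF_hom_carrier)
        then show ?thesis
          using 2 QF_hom_bottom_le[OF w] by (auto simp: g_def QF_cmp_def split: arrow.split)
      next
        case 3
        then show ?thesis using u' v w r
          by (cases u; cases v; cases w)
            (simp_all add: g_def QF_cmp_def QF_hom_carrier adj_int)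
      next
        case 4
        then have "v \<noteq> Unit" using v by (auto simp: QF_hom_carrier)
        with 4 have "QF_cmp amp p q r v u = \<bottom>\<^bsub>QF_hom p r\<^esub>"
          by (intro QF_cmp_bottom u' v)
        moreover have "g w = top_qr" using 4 u' w
          by (cases u; cases w) (simp_all add: g_def QF_hom_carrier)
        moreover have "arrow_le v top_qr" using v 4
          by (cases v) (auto simp: top_qr_def QF_hom_carrier)
        ultimately show ?thesis using QF_hom_bottom_le[OF w] by simp
      qed
    qed
    then show "Cmp (QF n amp) p q r v u \<sqsubseteq>\<^bsub>Hom (QF n amp) p r\<^esub> w \<longleftrightarrow>
        v \<sqsubseteq>\<^bsub>Hom (QF n amp) q r\<^esub> g w"
      by (simp add: QF_def)
  qed
qed

lemma QF_left_impl:
  assumes i: "i \<in> {1..n}"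
  shows "left_impl (QF n amp) (-1) 0 (int i) (InP z) (InL1 x) = InL2 (nw i z x)"
proof -
  interpret quantaloid "QF n amp" by (rule quantaloid_QF)
  have C: "carrier (Hom (QF n amp) 0 (int i)) = range InL2"
    using i by (simp add: QF_def QF_hom_def)
  have *: "Cmp (QF n amp) (-1) 0 (int i) v (InL1 x) \<sqsubseteq>\<^bsub>Hom (QF n amp) (-1) (int i)\<^esub> InP z \<longleftrightarrow>
      v \<sqsubseteq>\<^bsub>Hom (QF n amp) 0 (int i)\<^esub> InL2 (nw i z x)" if "v \<in> range InL2" for v
    using that adj_nw[OF i] by (auto simp: QF_def QF_cmp_def)
  have ob: "-1 \<in> Ob (QF n amp)" "0 \<in> Ob (QF n amp)" "int i \<in> Ob (QF n amp)"
    using i by (simp_all add: QF_def)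
  have w: "InL1 x \<in> carrier (Hom (QF n amp) (-1) 0)" "InP z \<in> carrier (Hom (QF n amp) (-1) (int i))"
    using i by (simp_all add: QF_def QF_hom_carrier)
  obtain y where y: "left_impl (QF n amp) (-1) 0 (int i) (InP z) (InL1 x) = InL2 y"
    using left_impl(1)[OF ob w] C by auto
  have "InL2 b \<sqsubseteq>\<^bsub>Hom (QF n amp) 0 (int i)\<^esub> InL2 y \<longleftrightarrow>
      InL2 b \<sqsubseteq>\<^bsub>Hom (QF n amp) 0 (int i)\<^esub> InL2 (nw i z x)" for b
    using left_impl(2)[OF ob w, of "InL2 b"] *[of "InL2 b"] C y by simp
  then have "b \<le> y \<longleftrightarrow> b \<le> nw i z x" for b by (simp add: QF_def)
  then have "y = nw i z x" using order.antisym by blast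
  with y show ?thesis by simp
qed

lemma QF_right_impl:
  assumes i: "i \<in> {1..n}"
  shows "right_impl (QF n amp) (-1) 0 (int i) (InL2 y) (InP z) = InL1 (sw i z y)"
proof -
  interpret quantaloid "QF n amp" by (rule quantaloid_QF)
  have C: "carrier (Hom (QF n amp) (-1) 0) = range InL1"
    by (simp add: QF_def QF_hom_def)
  have *: "Cmp (QF n amp) (-1) 0 (int i) (InL2 y) u \<sqsubseteq>\<^bsub>Hom (QF n amp) (-1) (int i)\<^esub> InP z \<longleftrightarrow>
      u \<sqsubseteq>\<^bsub>Hom (QF n amp) (-1) 0\<^esub> InL1 (sw i z y)" if "u \<in> range InL1" for u
    using that adj_sw[OF i] by (auto simp: QF_def QF_cmp_def)
  have ob: "-1 \<in> Ob (QF n amp)" "0 \<in> Ob (QF n amp)" "int i \<in> Ob (QF n amp)"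
    using i by (simp_all add: QF_def)
  have w: "InL2 y \<in> carrier (Hom (QF n amp) 0 (int i))" "InP z \<in> carrier (Hom (QF n amp) (-1) (int i))"
    using i by (simp_all add: QF_def QF_hom_carrier)
  obtain x where x: "right_impl (QF n amp) (-1) 0 (int i) (InL2 y) (InP z) = InL1 x"
    using right_impl(1)[OF ob w] C by auto
  have "InL1 a \<sqsubseteq>\<^bsub>Hom (QF n amp) (-1) 0\<^esub> InL1 x \<longleftrightarrow>
      InL1 a \<sqsubseteq>\<^bsub>Hom (QF n amp) (-1) 0\<^esub> InL1 (sw i z y)" for a
    using right_impl(2)[OF ob w, of "InL1 a"] *[of "InL1 a"] C x by simp
  then have "a \<le> x \<longleftrightarrow> a \<le> sw i z y" for a by (simp add: QF_def)
  then have "x = sw i z y" using order.antisym by blast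
  with x show ?thesis by simp
qed

lemma qrel_QF_rel:
  assumes "ty \<in> Y \<rightarrow> {1..n}"
  shows "qrel (QF n amp) (QF_rel X Y phi ty)"
proof -
  interpret quantaloid "QF n amp" by (rule quantaloid_QF)
  show ?thesis
    by unfold_locales (use assms in \<open>auto simp: QF_def QF_rel_def QF_hom_carrier Pi_iff\<close>)
qed

end

end

(* Both lattices consist of the closed maps X -> L1, ordered pointwise. Between the hom-sets
   -1 -> 0 -> i the implications of the quantaloid are those of the frame and infima are computed
   in L1 and L2, so the Isbell operators restricted to type 0 are the two derivation operators.
   A concept is determined by its second component, and the order of the fibre is pointwise
   because the identity is a unit for composition. *)
theory Submission
  imports Defs
begin

section \<open>Order isomorphisms\<close>

text \<open>By surjectivity every upper bound of the image of \<open>A\<close> has the form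
  \<open>f b\<close>; since \<open>f\<close> reflects the order, \<open>b\<close> is an upper bound
  of \<open>A\<close>, so \<open>s\<close> lies below it. \<open>L\<close> and \<open>M\<close> are
  bare order records, which lets the result be applied to inverse orders.\<close>

lemma order_iso_least_Upper:
  assumes bij: "bij_betw f (carrier L) (carrier M)"
    and le: "\<And>a b. \<lbrakk>a \<in> carrier L; b \<in> carrier L\<rbrakk> \<Longrightarrow> f a \<sqsubseteq>\<^bsub>M\<^esub> f b \<longleftrightarrow> a \<sqsubseteq>\<^bsub>L\<^esub> b"
    and A: "A \<subseteq> carrier L" and s: "least L s (Upper L A)"
  shows "least M (f s) (Upper M (f ` A))"
proof (rule least_UpperI)
  have sL: "s \<in> carrier L" using s by (auto simp: least_def Upper_def)
  show "f s \<in> carrier M" using bij sL by (auto simp: bij_betw_def)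
  show "f ` A \<subseteq> carrier M" using bij A by (auto simp: bij_betw_def)
  show "x \<sqsubseteq>\<^bsub>M\<^esub> f s" if "x \<in> f ` A" for x
    using that A s sL le by (auto simp: least_def Upper_def)
  show "f s \<sqsubseteq>\<^bsub>M\<^esub> y" if y: "y \<in> Upper M (f ` A)" for y
  proof -
    obtain b where b: "b \<in> carrier L" "y = f b"
      using y bij unfolding bij_betw_def Upper_def by blast
    moreover have "a \<sqsubseteq>\<^bsub>L\<^esub> b" if "a \<in> A" for a
    proof -
      have "f a \<sqsubseteq>\<^bsub>M\<^esub> f b" using y b that \<open>f ` A \<subseteq> carrier M\<close> by (auto simp: Upper_def)
      then show ?thesis using le that A b by blast
    qed
    ultimately have "s \<sqsubseteq>\<^bsub>L\<^esub> b" using s by (auto simp: least_def Upper_def)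
    then show ?thesis using le sL b by simp
  qed
qed

text \<open>Duality: in the inverse orders lower bounds become upper bounds and greatest elements
  become least ones.\<close>

lemma order_iso_greatest_Lower:
  assumes bij: "bij_betw f (carrier L) (carrier M)"
    and le: "\<And>a b. \<lbrakk>a \<in> carrier L; b \<in> carrier L\<rbrakk> \<Longrightarrow> f a \<sqsubseteq>\<^bsub>M\<^esub> f b \<longleftrightarrow> a \<sqsubseteq>\<^bsub>L\<^esub> b"
    and A: "A \<subseteq> carrier L" and i: "greatest L i (Lower L A)"
  shows "greatest M (f i) (Lower M (f ` A))"
proof -
  have "least (inv_gorder M) (f i) (Upper (inv_gorder M) (f ` A))"
    by (rule order_iso_least_Upper[where L = "inv_gorder L"])
      (use assms in \<open>auto simp: least_def greatest_def\<close>)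
  then show ?thesis by (simp add: least_def greatest_def)
qed

text \<open>Bounds of subsets are transported along \<open>f\<close>, so completeness passes from
  \<open>L\<close> to \<open>M\<close>, and uniqueness of suprema and infima shows that
  \<open>f\<close> preserves them. Antisymmetry of a record order is stated up to its field
  \<open>eq\<close>, hence the condition on \<open>eq M\<close>.\<close>

lemma order_iso_complete_lattice_iso:
  assumes L: "complete_lattice L" and M: "eq M = (=)"
    and bij: "bij_betw f (carrier L) (carrier M)"
    and le: "\<And>a b. \<lbrakk>a \<in> carrier L; b \<in> carrier L\<rbrakk> \<Longrightarrow> f a \<sqsubseteq>\<^bsub>M\<^esub> f b \<longleftrightarrow> a \<sqsubseteq>\<^bsub>L\<^esub> b"
  shows "complete_lattice_iso L M f"
proof -
  interpret L: complete_lattice L by fact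
  have img: "carrier M = f ` carrier L" using bij by (simp add: bij_betw_def)
  interpret M: partial_order M
  proof
    fix x y z assume "x \<sqsubseteq>\<^bsub>M\<^esub> y" "y \<sqsubseteq>\<^bsub>M\<^esub> z" "x \<in> carrier M" "y \<in> carrier M" "z \<in> carrier M"
    then show "x \<sqsubseteq>\<^bsub>M\<^esub> z" unfolding img by (auto simp: le intro: L.le_trans)
    fix x y assume "x \<sqsubseteq>\<^bsub>M\<^esub> y" "y \<sqsubseteq>\<^bsub>M\<^esub> x" "x \<in> carrier M" "y \<in> carrier M"
    moreover obtain a b where "x = f a" "y = f b" "a \<in> carrier L" "b \<in> carrier L"
      using calculation(3,4) unfolding img by blast
    ultimately show "x .=\<^bsub>M\<^esub> y" using L.le_antisym[of a b] by (simp add: le M)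
  qed (auto simp: M img le)
  have sub: "\<exists>B. B \<subseteq> carrier L \<and> A = f ` B" if "A \<subseteq> carrier M" for A
    using that unfolding img by (auto simp: subset_image_iff)
  interpret M: complete_lattice M
  proof
    fix A assume "A \<subseteq> carrier M"
    then obtain B where B: "B \<subseteq> carrier L" "A = f ` B" using sub by blast
    show "\<exists>s. least M s (Upper M A)"
      using order_iso_least_Upper[OF bij le B(1)] L.sup_exists[OF B(1)] B(2) by blast
    show "\<exists>i. greatest M i (Lower M A)"
      using order_iso_greatest_Lower[OF bij le B(1)] L.inf_exists[OF B(1)] B(2) by blast
  qed
  have "f (\<Squnion>\<^bsub>L\<^esub>A) = \<Squnion>\<^bsub>M\<^esub>(f ` A)" if A: "A \<subseteq> carrier L" for A
  proof -
    have "f ` A \<subseteq> carrier M" using A img by auto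
    then show ?thesis
      by (intro M.least_unique[OF order_iso_least_Upper[OF bij le A L.sup_lub[OF A]] M.sup_lub])
  qed
  moreover have "f (\<Sqinter>\<^bsub>L\<^esub>A) = \<Sqinter>\<^bsub>M\<^esub>(f ` A)" if A: "A \<subseteq> carrier L" for A
  proof -
    have "f ` A \<subseteq> carrier M" using A img by auto
    then show ?thesis
      by (intro M.greatest_unique[OF order_iso_greatest_Lower[OF bij le A L.inf_glb[OF A]] M.inf_glb])
  qed
  ultimately show ?thesis
    using bij L M.complete_lattice_axioms
    by (simp add: complete_lattice_iso_def sup_pres_def inf_pres_def)
qed


section \<open>Multi-adjoint concept lattices\<close>

context multi_adjoint_frame
begin

text \<open>Both sides say that \<open>amp (ty y) (mu x) (lam y)\<close> lies below
  \<open>phi x y\<close> for all \<open>x\<close> in \<open>X\<close> and \<open>y\<close> in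
  \<open>Y\<close>.\<close>

lemma concept_galois:
  assumes "ty \<in> Y \<rightarrow> {1..n}"
  shows "(\<forall>y\<in>Y. lam y \<le> concept_up nw X Y phi ty mu y) \<longleftrightarrow>
    (\<forall>x\<in>X. mu x \<le> concept_down sw X Y phi ty lam x)"
proof -
  have "lam y \<le> nw (ty y) (phi x y) (mu x) \<longleftrightarrow> mu x \<le> sw (ty y) (phi x y) (lam y)"
    if "y \<in> Y" for x y
    using adj_sw adj_nw assms that by (metis Pi_mem)
  then show ?thesis
    by (auto simp: concept_up_def concept_down_def le_INF_iff)
qed

text \<open>General facts about a Galois connection: the unit laws come from reflexivity,
  antitonicity follows from a unit law and the adjunction, and the closure is a composite of two
  antitone maps.\<close>

lemma
  fixes phi :: "'x \<Rightarrow> 'y \<Rightarrow> 'p" and X :: "'x set" and Y :: "'y set"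
  assumes ty: "ty \<in> Y \<rightarrow> {1..n}"
  defines "up \<equiv> concept_up nw X Y phi ty" and "down \<equiv> concept_down sw X Y phi ty"
  shows concept_closure_mono:
      "\<lbrakk>\<And>x. x \<in> X \<Longrightarrow> mu x \<le> mu' x; x \<in> X\<rbrakk> \<Longrightarrow> down (up mu) x \<le> down (up mu') x"
    and concept_up_closure: "up (down (up mu)) = up mu"
proof -
  have galois: "(\<forall>y\<in>Y. l y \<le> up m y) \<longleftrightarrow> (\<forall>x\<in>X. m x \<le> down l x)" for l m
    unfolding up_def down_def by (rule concept_galois[OF ty])
  have ext: "m x \<le> down (up m) x" if "x \<in> X" for m x
    using galois[of "up m" m] that by simp
  have ext': "l y \<le> up (down l) y" if "y \<in> Y" for l y
    using galois[of l "down l"] that by simp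
  have up_anti: "up m' y \<le> up m y" if "\<And>x. x \<in> X \<Longrightarrow> m x \<le> m' x" "y \<in> Y" for m m' y
    using galois[of "up m'" m] ext[of _ m'] that order.trans by blast
  have down_anti: "down l' x \<le> down l x" if "\<And>y. y \<in> Y \<Longrightarrow> l y \<le> l' y" "x \<in> X" for l l' x
    using galois[of l "down l'"] ext'[of _ l'] that order.trans by blast
  show "\<lbrakk>\<And>x. x \<in> X \<Longrightarrow> mu x \<le> mu' x; x \<in> X\<rbrakk> \<Longrightarrow> down (up mu) x \<le> down (up mu') x"
    by (rule down_anti[OF up_anti])
  show "up (down (up mu)) = up mu"
  proof
    fix y
    show "up (down (up mu)) y = up mu y"
    \<comment> \<open>On \<open>Y\<close>, antitonicity applied to the unit at \<open>mu\<close>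
      gives one inequality, and the unit at \<open>up mu\<close> gives the other. Off
      \<open>Y\<close> both sides are \<open>undefined\<close>.\<close>
    proof (cases "y \<in> Y")
      case True
      then show ?thesis
        using up_anti[of mu "down (up mu)" y] ext[of _ mu] ext'[of y "up mu"]
        by (intro order.antisym) simp_all
    qed (simp add: up_def concept_up_def)
  qed
qed

text \<open>It suffices to construct infima, by closing the pointwise infimum of the second
  components. The infimum of the empty set is the top element that the completeness criterion asks
  for.\<close>

lemma complete_lattice_concept_lattice:
  assumes ty: "ty \<in> Y \<rightarrow> {1..n}"
  shows "complete_lattice (concept_lattice sw nw X Y phi ty)" (is "complete_lattice ?C")
proof -
  let ?up = "concept_up nw X Y phi ty" and ?down = "concept_down sw X Y phi ty"
  \<comment> \<open>Membership in the function spaces follows from the fixed-point equations,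
    because both operators return extensional functions.\<close>
  have car: "a \<in> carrier ?C \<longleftrightarrow> ?up (snd a) = fst a \<and> ?down (fst a) = snd a" for a
  proof -
    have "?up m \<in> Y \<rightarrow>\<^sub>E UNIV" "?down l \<in> X \<rightarrow>\<^sub>E UNIV" for l m
      by (auto simp: concept_up_def concept_down_def)
    moreover have "a \<in> carrier ?C \<longleftrightarrow> fst a \<in> Y \<rightarrow>\<^sub>E UNIV \<and> snd a \<in> X \<rightarrow>\<^sub>E UNIV \<and>
        ?up (snd a) = fst a \<and> ?down (fst a) = snd a"
      by (simp add: concept_lattice_def case_prod_beta)
    ultimately show ?thesis by metis
  qed
  have le: "a \<sqsubseteq>\<^bsub>?C\<^esub> b \<longleftrightarrow> (\<forall>x\<in>X. snd a x \<le> snd b x)" for a b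
    by (simp add: concept_lattice_def case_prod_beta)
  have ext: "m \<in> extensional X" if "a \<in> carrier ?C" "m = snd a" for a m
    using that by (auto simp: concept_lattice_def PiE_def)
  interpret partial_order ?C
  proof
    show eq: "(.=\<^bsub>?C\<^esub>) = (=)" by (simp add: concept_lattice_def)
    show "x .=\<^bsub>?C\<^esub> y" if "x \<sqsubseteq>\<^bsub>?C\<^esub> y" "y \<sqsubseteq>\<^bsub>?C\<^esub> x" "x \<in> carrier ?C" "y \<in> carrier ?C" for x y
    proof -
      \<comment> \<open>The order compares second components only; the first components then agree
        because each is \<open>?up\<close> of the second.\<close>
      have "snd x = snd y"
        by (rule extensionalityI[OF ext[OF that(3) refl] ext[OF that(4) refl]])
          (use that in \<open>auto simp: le intro: order.antisym\<close>)
      then show ?thesis using that(3,4) by (simp add: eq car prod_eq_iff)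
    qed
  qed (auto simp: le concept_lattice_def intro: order.trans)
  have inf: "\<exists>i. greatest ?C i (Lower ?C A)" if A: "A \<subseteq> carrier ?C" for A
  proof -
    \<comment> \<open>\<open>m\<close> need not be extensional; its closure yields a member of the
      carrier at once, also when \<open>A\<close> is empty.\<close>
    define m where "m = (\<lambda>x. INF a\<in>A. snd a x)"
    let ?i = "(?up m, ?down (?up m))"
    have closed: "?down (?up (snd a)) = snd a" if "a \<in> carrier ?C" for a
      using that by (simp add: car)
    have i: "?i \<in> carrier ?C" by (simp add: car concept_up_closure[OF ty])
    have "greatest ?C ?i (Lower ?C A)"
    proof (rule greatest_LowerI[OF _ _ A i])
      fix a assume a: "a \<in> A"
      then have "m x \<le> snd a x" for x by (auto simp: m_def intro: INF_lower)
      then have "?down (?up m) x \<le> ?down (?up (snd a)) x" if "x \<in> X" for x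
        by (rule concept_closure_mono[OF ty]) (use that in auto)
      moreover have "?down (?up (snd a)) = snd a" using a A by (intro closed) auto
      ultimately show "?i \<sqsubseteq>\<^bsub>?C\<^esub> a" by (simp add: le)
    next
      fix b assume b: "b \<in> Lower ?C A"
      then have bC: "b \<in> carrier ?C" by (simp add: Lower_def)
      have "snd b x \<le> m x" if "x \<in> X" for x
        using b A that by (auto simp: m_def Lower_def le intro!: INF_greatest)
      then have "?down (?up (snd b)) x \<le> ?down (?up m) x" if "x \<in> X" for x
        by (rule concept_closure_mono[OF ty]) (use that in auto)
      then show "b \<sqsubseteq>\<^bsub>?C\<^esub> ?i" using closed[OF bC] by (simp add: le)
    qed
    then show ?thesis ..
  qed
  show ?thesis
    using inf[of "{}"] by (intro complete_lattice_criterion1 inf) simp_all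
qed

end


section \<open>Presheaves over the quantaloid of a frame\<close>

text \<open>By residuation the identity lies below the implication from \<open>mu x\<close> to
  \<open>mu' x\<close> exactly when its composite with \<open>mu x\<close>, which is
  \<open>mu x\<close> itself, lies below \<open>mu' x\<close>.\<close>

lemma (in quantaloid) fibre_presheaf_le:
  assumes t: "\<And>x. x \<in> X \<Longrightarrow> t x \<in> Ob Q"
    and a: "(q, mu) \<in> presheaves Q X t" and b: "(q, mu') \<in> presheaves Q X t"
  shows "Idt Q q \<sqsubseteq>\<^bsub>Hom Q q q\<^esub> QHom (presheaf_qcat Q X t) (q, mu) (q, mu') \<longleftrightarrow>
    (\<forall>x\<in>X. mu x \<sqsubseteq>\<^bsub>Hom Q (t x) q\<^esub> mu' x)"
proof -
  have q: "q \<in> Ob Q" using a by (simp add: presheaves_def)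
  have mu: "mu x \<in> carrier (Hom Q (t x) q)" "mu' x \<in> carrier (Hom Q (t x) q)" if "x \<in> X" for x
    using a b that by (auto simp: presheaves_def)
  interpret complete_lattice "Hom Q q q" using q by (intro hom_complete)
  let ?I = "\<lambda>x. left_impl Q (t x) q q (mu' x) (mu x)"
  have sub: "?I ` X \<subseteq> carrier (Hom Q q q)"
    using t q mu by (intro image_subsetI left_impl(1))
  have id: "Idt Q q \<in> carrier (Hom Q q q)" using q by (rule idt_closed)
  have "Idt Q q \<sqsubseteq>\<^bsub>Hom Q q q\<^esub> \<Sqinter>\<^bsub>Hom Q q q\<^esub>(?I ` X) \<longleftrightarrow>
      (\<forall>x\<in>X. Idt Q q \<sqsubseteq>\<^bsub>Hom Q q q\<^esub> ?I x)"
  proof (intro iffI ballI)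
    fix x assume l: "Idt Q q \<sqsubseteq>\<^bsub>Hom Q q q\<^esub> \<Sqinter>\<^bsub>Hom Q q q\<^esub>(?I ` X)" and x: "x \<in> X"
    have "\<Sqinter>\<^bsub>Hom Q q q\<^esub>(?I ` X) \<sqsubseteq>\<^bsub>Hom Q q q\<^esub> ?I x"
      using sub x by (intro inf_lower) auto
    with l show "Idt Q q \<sqsubseteq>\<^bsub>Hom Q q q\<^esub> ?I x"
      by (rule le_trans[OF _ _ id inf_closed[OF sub]]) (use sub x in auto)
  next
    assume "\<forall>x\<in>X. Idt Q q \<sqsubseteq>\<^bsub>Hom Q q q\<^esub> ?I x"
    then show "Idt Q q \<sqsubseteq>\<^bsub>Hom Q q q\<^esub> \<Sqinter>\<^bsub>Hom Q q q\<^esub>(?I ` X)"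
      by (intro inf_greatest sub id) auto
  qed
  also have "\<dots> \<longleftrightarrow> (\<forall>x\<in>X. mu x \<sqsubseteq>\<^bsub>Hom Q (t x) q\<^esub> mu' x)"
  proof (intro ball_cong HOL.refl)
    fix x assume x: "x \<in> X"
    show "Idt Q q \<sqsubseteq>\<^bsub>Hom Q q q\<^esub> ?I x \<longleftrightarrow> mu x \<sqsubseteq>\<^bsub>Hom Q (t x) q\<^esub> mu' x"
      using left_impl(2)[OF t[OF x] q q mu[OF x] id] idt_left[OF t[OF x] q mu(1)[OF x]] by simp
  qed
  finally show ?thesis by (simp add: presheaf_qcat_def)
qed

text \<open>\<open>c\<close> is an order isomorphism onto its range, so it carries type class infima
  to infima of the record order. The hom-sets \<open>L1\<close> and \<open>L2\<close> of the
  quantaloid are such tagged copies.\<close>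

lemma complete_lattice_embedding_Inf:
  fixes c :: "'l::complete_lattice \<Rightarrow> 'a"
  assumes le: "\<And>a b. r (c a) (c b) \<longleftrightarrow> a \<le> b" and c: "inj c"
  shows "\<Sqinter>\<^bsub>\<lparr>carrier = range c, eq = (=), le = r\<rparr>\<^esub>(c ` B) = c (Inf B)"
    (is "\<Sqinter>\<^bsub>?L\<^esub>_ = _")
proof -
  interpret complete_lattice ?L by (rule complete_lattice_embedding[OF le c])
  have "greatest ?L (c (Inf B)) (Lower ?L (c ` B))"
  proof (rule greatest_LowerI)
    fix y assume "y \<in> Lower ?L (c ` B)"
    then obtain d where "y = c d" "\<And>b. b \<in> B \<Longrightarrow> r (c d) (c b)"
      by (auto simp: Lower_def)
    then show "y \<sqsubseteq>\<^bsub>?L\<^esub> c (Inf B)" by (simp add: le le_Inf_iff)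
  qed (auto simp: le intro: Inf_lower)
  then show ?thesis
    by (intro greatest_unique[OF inf_glb]) auto
qed

lemma QF_hom_Inf_InL1:
  fixes B :: "'l1::complete_lattice set"
  shows "\<Sqinter>\<^bsub>QF_hom (-1) 0 :: ('l1, 'l2::ord, 'p::ord) arrow gorder\<^esub>(InL1 ` B) = InL1 (Inf B)"
  unfolding QF_hom_def by (simp add: complete_lattice_embedding_Inf inj_def)

lemma QF_hom_Inf_InL2:
  fixes B :: "'l2::complete_lattice set"
  assumes "1 \<le> i"
  shows "\<Sqinter>\<^bsub>QF_hom 0 i :: ('l1::ord, 'l2, 'p::ord) arrow gorder\<^esub>(InL2 ` B) = InL2 (Inf B)"
  unfolding QF_hom_def using assms by (simp add: complete_lattice_embedding_Inf inj_def)

section \<open>The Isbell operators at type 0\<close>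

context multi_adjoint_frame
begin

text \<open>For fixed \<open>y\<close> all left implications lie in the hom-set from 0 to
  \<open>ty y\<close>, a copy of \<open>L2\<close>, where they are given by
  \<open>nw (ty y)\<close>.\<close>

lemma isbell_up_QF:
  assumes ty: "ty \<in> Y \<rightarrow> {1..n}"
  shows "isbell_up (QF n amp) (QF_rel X Y phi ty) (0, \<lambda>x\<in>X. InL1 (mu x)) =
    (0, \<lambda>y\<in>Y. InL2 (concept_up nw X Y phi ty mu y))"
proof -
  have "\<Sqinter>\<^bsub>QF_hom 0 (int (ty y)) :: ('l1, 'l2, 'p) arrow gorder\<^esub>
      ((\<lambda>x. left_impl (QF n amp) (-1) 0 (int (ty y)) (InP (phi x y)) ((\<lambda>x\<in>X. InL1 (mu x)) x)) ` X) =
      InL2 (concept_up nw X Y phi ty mu y)" if y: "y \<in> Y" for y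
  proof -
    have i: "ty y \<in> {1..n}" using ty y by auto
    \<comment> \<open>Pulling the tag \<open>InL2\<close> out of the image turns the infimum of
      arrows into one in \<open>L2\<close>.\<close>
    have "(\<lambda>x. left_impl (QF n amp) (-1) 0 (int (ty y)) (InP (phi x y)) ((\<lambda>x\<in>X. InL1 (mu x)) x)) ` X =
        InL2 ` (\<lambda>x. nw (ty y) (phi x y) (mu x)) ` X"
      unfolding image_image using QF_left_impl[OF i] by (intro image_cong) simp_all
    then show ?thesis using i y by (simp add: QF_hom_Inf_InL2 concept_up_def)
  qed
  then show ?thesis
    by (auto simp: isbell_up_def QF_rel_def QF_def[of n amp] intro!: restrict_ext)
qed

text \<open>The types \<open>ty y\<close> vary within the infimum, but every right implication lands
  in the single hom-set from -1 to 0, a copy of \<open>L1\<close>.\<close>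

lemma isbell_down_QF:
  assumes ty: "ty \<in> Y \<rightarrow> {1..n}"
  shows "isbell_down (QF n amp) (QF_rel X Y phi ty) (0, \<lambda>y\<in>Y. InL2 (lam y)) =
    (0, \<lambda>x\<in>X. InL1 (concept_down sw X Y phi ty lam x))"
proof -
  have "\<Sqinter>\<^bsub>QF_hom (-1) 0 :: ('l1, 'l2, 'p) arrow gorder\<^esub>
      ((\<lambda>y. right_impl (QF n amp) (-1) 0 (int (ty y)) ((\<lambda>y\<in>Y. InL2 (lam y)) y) (InP (phi x y))) ` Y) =
      InL1 (concept_down sw X Y phi ty lam x)" if x: "x \<in> X" for x
  proof -
    have i: "ty y \<in> {1..n}" if "y \<in> Y" for y using ty that by auto
    have "(\<lambda>y. right_impl (QF n amp) (-1) 0 (int (ty y)) ((\<lambda>y\<in>Y. InL2 (lam y)) y) (InP (phi x y))) ` Y =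
        InL1 ` (\<lambda>y. sw (ty y) (phi x y) (lam y)) ` Y"
      unfolding image_image using QF_right_impl[OF i] by (intro image_cong) simp_all
    then show ?thesis using x by (simp add: QF_hom_Inf_InL1 concept_down_def)
  qed
  then show ?thesis
    by (auto simp: isbell_down_def QF_rel_def QF_def[of n amp] intro!: restrict_ext)
qed

end

section \<open>Comparison of the concept lattice with the 0-fibre\<close>

theorem theorem4p2:
  fixes amp :: "nat \<Rightarrow> 'l1::complete_lattice \<Rightarrow> 'l2::complete_lattice \<Rightarrow> 'p::complete_lattice"
    and phi :: "'x \<Rightarrow> 'y \<Rightarrow> 'p"
  assumes "multi_adjoint_frame n amp sw nw"
    and "ty \<in> Y \<rightarrow> {1..n}"
  shows "complete_lattice_isomorphic
           (concept_lattice sw nw X Y phi ty)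
           (fibre (QF n amp) (isbell_fixed (QF n amp) (QF_rel X Y phi ty)) 0)"
proof -
  interpret multi_adjoint_frame n amp sw nw by fact
  note ty = assms(2)
  let ?C = "concept_lattice sw nw X Y phi ty"
  let ?Q = "QF n amp" and ?R = "QF_rel X Y phi ty :: (int, ('l1, 'l2, 'p) arrow, 'x, 'y) qrel_data"
  let ?F = "fibre ?Q (isbell_fixed ?Q ?R) 0"
  let ?up = "concept_up nw X Y phi ty" and ?down = "concept_down sw X Y phi ty"
  interpret quantaloid ?Q by (rule quantaloid_QF)
  define emb :: "('x \<Rightarrow> 'l1) \<Rightarrow> int \<times> ('x \<Rightarrow> ('l1, 'l2, 'p) arrow)"
    where "emb mu = (0, \<lambda>x\<in>X. InL1 (mu x))" for mu
  have Src: "Src ?R = X" "STyp ?R = (\<lambda>_. -1)" by (simp_all add: QF_rel_def)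
  have pre: "emb mu \<in> presheaves ?Q X (\<lambda>_. -1)" for mu
    by (auto simp: emb_def presheaves_def QF_def QF_hom_carrier)
  \<comment> \<open>Type 0 forces the values into the hom-set from -1 to 0, so the tag
    \<open>InL1\<close> can be stripped; restricting the chosen \<open>g\<close> to \<open>X\<close>
    gives an extensional representative.\<close>
  have pre_emb: "\<exists>mu\<in>extensional X. a = emb mu"
    if pa: "a \<in> presheaves ?Q X (\<lambda>_. -1)" "fst a = 0" for a
  proof -
    obtain m where a: "a = (0, m)" "m \<in> X \<rightarrow>\<^sub>E range InL1"
      using pa by (cases a) (auto simp: presheaves_def QF_def QF_hom_def)
    then have "\<forall>x\<in>X. \<exists>b. m x = InL1 b" by blast
    then obtain g where g: "\<And>x. x \<in> X \<Longrightarrow> m x = InL1 (g x)" by metis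
    have "m = (\<lambda>x\<in>X. InL1 (g x))" using a g by (intro ext) (auto simp: PiE_def extensional_def)
    then show ?thesis
      using a by (intro bexI[of _ "restrict g X"]) (auto simp: emb_def intro: restrict_ext)
  qed
  \<comment> \<open>\<open>emb\<close> ignores values off \<open>X\<close>, so it can separate only
    extensional maps.\<close>
  have emb_eq: "emb m = emb m' \<longleftrightarrow> m = m'" if "m \<in> extensional X" "m' \<in> extensional X" for m m'
  proof
    assume "emb m = emb m'"
    then have *: "(\<lambda>x\<in>X. InL1 (m x)) = (\<lambda>x\<in>X. InL1 (m' x) :: ('l1, 'l2, 'p) arrow)"
      by (simp add: emb_def)
    show "m = m'"
    proof (rule extensionalityI[OF that])
      show "m x = m' x" if "x \<in> X" for x using fun_cong[OF *, of x] that by simp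
    qed
  qed simp
  have closure: "isbell_down ?Q ?R (isbell_up ?Q ?R (emb mu)) = emb (?down (?up mu))" for mu
    unfolding emb_def by (simp only: isbell_up_QF[OF ty] isbell_down_QF[OF ty])
  have down_ext: "?down l \<in> extensional X" for l by (simp add: concept_down_def)
  \<comment> \<open>Both carriers are images of one set of closed maps; a closed map
    \<open>m\<close> is completed to a concept by \<open>?up m\<close>.\<close>
  have carC: "carrier ?C = (\<lambda>m. (?up m, m)) ` {m \<in> extensional X. ?down (?up m) = m}"
    by (auto simp: concept_lattice_def concept_up_def PiE_def)
  have carF: "carrier ?F = emb ` {m \<in> extensional X. ?down (?up m) = m}"
  proof -
    have F: "a \<in> carrier ?F \<longleftrightarrow>
        a \<in> presheaves ?Q X (\<lambda>_. -1) \<and> isbell_down ?Q ?R (isbell_up ?Q ?R a) = a \<and> fst a = 0" for a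
      by (auto simp: fibre_def isbell_fixed_def presheaf_qcat_def Src)
    \<comment> \<open>Since \<open>?down\<close> returns extensional maps, injectivity of
      \<open>emb\<close> reduces the Isbell fixed-point equation to that of the derivation
      operators.\<close>
    have embF: "emb m \<in> carrier ?F \<longleftrightarrow> ?down (?up m) = m" if "m \<in> extensional X" for m
      unfolding F closure emb_eq[OF down_ext that] using pre by (simp add: emb_def)
    show ?thesis
    proof (intro subset_antisym subsetI)
      fix a assume a: "a \<in> carrier ?F"
      then obtain m where "m \<in> extensional X" "a = emb m" using F pre_emb by blast
      then show "a \<in> emb ` {m \<in> extensional X. ?down (?up m) = m}" using a embF by simp
    qed (use embF in auto)
  qed
  have "complete_lattice_iso ?C ?F (emb \<circ> snd)"
  proof (rule order_iso_complete_lattice_iso[OF complete_lattice_concept_lattice[OF ty]])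
    show "eq ?F = (=)" by (simp add: fibre_def)
    show "bij_betw (emb \<circ> snd) (carrier ?C) (carrier ?F)"
      unfolding carC carF by (auto simp: bij_betw_def inj_on_def emb_eq image_image)
    \<comment> \<open>Fixed presheaves inherit their hom-arrows from the category of all presheaves,
      so the order can be computed there.\<close>
    fix a b :: "('y \<Rightarrow> 'l2) \<times> ('x \<Rightarrow> 'l1)"
    have "(emb \<circ> snd) a \<sqsubseteq>\<^bsub>?F\<^esub> (emb \<circ> snd) b \<longleftrightarrow>
        Idt ?Q 0 \<sqsubseteq>\<^bsub>Hom ?Q 0 0\<^esub> QHom (presheaf_qcat ?Q X (\<lambda>_. -1)) (emb (snd a)) (emb (snd b))"
      by (simp add: fibre_def isbell_fixed_def Src)
    also have "\<dots> \<longleftrightarrow> (\<forall>x\<in>X. snd a x \<le> snd b x)"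
      using fibre_presheaf_le[of X "\<lambda>_. -1", OF _ pre[unfolded emb_def] pre[unfolded emb_def]]
      by (simp add: emb_def QF_def)
    finally show "(emb \<circ> snd) a \<sqsubseteq>\<^bsub>?F\<^esub> (emb \<circ> snd) b \<longleftrightarrow> a \<sqsubseteq>\<^bsub>?C\<^esub> b"
      by (simp add: concept_lattice_def case_prod_beta)
  qed
  then show ?thesis unfolding complete_lattice_isomorphic_def by blast
qed

end
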